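(* For all $n\in\mathbb N_0$, $$\mathcal F_n=\frac{21}{2^n}\zeta(3)+\frac{\pi^2}{2^n}\sum_{m=1}^n\frac{2^{m-1}}{m}+\frac{3}{2^n}\sum_{m=1}^n\frac{2^m}{m}\left(H_{m-1}^2+H_{m-1}^{(2)}\right).$$
   Context: Let $T\subset\mathbb R^3$ be a tetrahedron with barycentric coordinates $\lambda_0,\dots,\lambda_3$ and let $⨍_T g\,\mathrm dx$ denote the mean value $|T|^{-1}\int_Tg\,\mathrm dx$ (the quantity below is independent of $T$). For $n\in\mathbb N_0$, $$\mathcal F_n=|T|^{-1}\int_T\frac{\lambda_1^n}{(\lambda_0+\lambda_1)^{n+1}(\lambda_0+\lambda_2)(\lambda_0+\lambda_3)}\,\mathrm dx,$$ which also has the representation $$\mathcal F_n=6\int_0^1\int_0^1\frac{x^n}{x+y-2xy}\log\left(\frac{1-xy}{(1-x)(1-y)}\right)\mathrm dy\,\mathrm dx.$$ Further $\zeta(3)=\sum_{j\ge1}j^{-3}$, $H_m=\sum_{j=1}^m\frac1j$, $H_m^{(2)}=\sum_{j=1}^m\frac1{j^2}$ for $m\in\mathbb N_0$ (empty sums are zero). *)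

theory Defs
  imports "HOL-Analysis.Analysis"
begin

text \<open>
  A non-degenerate tetrahedron in space is given by its labelled vertices
  \<open>v 0, \<dots>, v 3\<close>; values of \<open>v\<close> beyond index 3 are irrelevant. Injectivity is
  required separately because \<^const>\<open>affine_dependent\<close> speaks about the vertex set only.
\<close>

definition tetrahedron_vertices :: "(nat \<Rightarrow> real ^ 3) \<Rightarrow> bool" where
  "tetrahedron_vertices v \<longleftrightarrow> inj_on v {..3} \<and> \<not> affine_dependent (v ` {..3})"

definition tetrahedron :: "(nat \<Rightarrow> real ^ 3) \<Rightarrow> (real ^ 3) set" where
  "tetrahedron v = convex hull (v ` {..3})"

text \<open>
  The condition on indices beyond 3 only makes the coefficient family unique.
\<close>

definition barycentric :: "(nat \<Rightarrow> real ^ 3) \<Rightarrow> nat \<Rightarrow> real ^ 3 \<Rightarrow> real" where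
  "barycentric v i x =
     (THE c. (\<Sum>j\<le>3. c j) = 1 \<and> (\<Sum>j\<le>3. c j *\<^sub>R v j) = x \<and> (\<forall>j>3. c j = 0)) i"

definition mean_value :: "(real ^ 3) set \<Rightarrow> (real ^ 3 \<Rightarrow> real) \<Rightarrow> real" where
  "mean_value T g = (LINT x:T|lebesgue. g x) / measure lebesgue T"

text \<open>
  The denominator vanishes only on three edges, a null set, where division by zero
  gives the integrand the value 0.
\<close>

definition F_mean :: "(nat \<Rightarrow> real ^ 3) \<Rightarrow> nat \<Rightarrow> real" where
  "F_mean v n = mean_value (tetrahedron v)
     (\<lambda>x. barycentric v 1 x ^ n /
        ((barycentric v 0 x + barycentric v 1 x) ^ (n + 1) *
         (barycentric v 0 x + barycentric v 2 x) *
         (barycentric v 0 x + barycentric v 3 x)))"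

definition zeta3 :: real where
  "zeta3 = (\<Sum>j. 1 / real (Suc j) ^ 3)"

definition harm2 :: "nat \<Rightarrow> real" where
  "harm2 m = (\<Sum>j=1..m. 1 / real j ^ 2)"

end

theory Submission
  imports Defs "HOL-Real_Asymp.Real_Asymp"
begin

text \<open>
  An affine map turns the tetrahedron into the standard simplex without changing the mean value
  (\<open>mean_value_affine_image\<close>), and there the integral over \<open>\<lambda>\<^sub>2\<close> is elementary. In the variables
  \<open>x = \<lambda>\<^sub>1 / (\<lambda>\<^sub>0 + \<lambda>\<^sub>1)\<close> and \<open>u = \<lambda>\<^sub>0 / (1 - \<lambda>\<^sub>1)\<close>, both ranging over the unit interval, the
  mean value becomes \<open>12 * J n\<close>, where \<open>J n\<close> is the integral of
  \<open>x ^ n * (- ln u) / ((1 + u) * (1 - x + x * u))\<close> over the unit square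
  (\<open>nn_integral_simplex_eq_log_kernel\<close>).

  The denominator \<open>1 - x + x * u\<close> equals \<open>1 - 2 * x\<close> at \<open>u = - 1\<close>, so in
  \<open>2 * J (n + 1) - J n\<close> the factor \<open>2 * x - 1\<close> is removed by partial fractions in \<open>u\<close>. What
  remains is the integral of \<open>x ^ (n + 1) * (- ln u) / (1 - x + x * u)\<close> minus
  \<open>\<pi>\<^sup>2 / (12 * (n + 1))\<close> (\<open>log_kernel_integral_Suc\<close>). A geometric expansion turns the former
  into the series of the terms \<open>H\<^sub>k / (k * (k + n + 1))\<close>, which summation by parts
  evaluates in terms of \<open>\<zeta>(2)\<close> and the harmonic numbers of first and second order (\<open>harm_Euler_sums\<close>). Finally \<open>J 0\<close> is
  the integral of \<open>(ln u)\<^sup>2 / (1 - u\<^sup>2)\<close>, which is \<open>7 / 4 * \<zeta>(3)\<close>, and solving the recursion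
  gives the formula.

  All integrands are nonnegative, so extended nonnegative integrals are used throughout: the theorems of
  Tonelli and Beppo Levi exchange integrals and sums, and finiteness of \<open>J n\<close> follows from the recursion.
\<close>

section \<open>Nonnegative integrals over the unit interval\<close>

text \<open>
  Primitives containing \<open>ln u\<close> have only a limit at \<open>0\<close>, which is why the
  boundary values are given by one-sided limits.
\<close>
lemma nn_integral_FTC_unit_interval:
  fixes f F :: "real \<Rightarrow> real"
  assumes der: "\<And>x. 0 < x \<Longrightarrow> x < 1 \<Longrightarrow> (F has_real_derivative f x) (at x)"
    and cont: "\<And>x. 0 < x \<Longrightarrow> x < 1 \<Longrightarrow> isCont f x"
    and nonneg: "\<And>x. 0 < x \<Longrightarrow> x < 1 \<Longrightarrow> 0 \<le> f x"
    and A: "(F \<longlongrightarrow> A) (at_right 0)" and B: "(F \<longlongrightarrow> B) (at_left 1)"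
  shows "(\<integral>\<^sup>+x\<in>{0<..<1}. ennreal (f x) \<partial>lborel) = ennreal (B - A)"
proof -
  have A': "((F \<circ> real_of_ereal) \<longlongrightarrow> A) (at_right 0)"
    using A by (simp add: zero_ereal_def ereal_tendsto_simps)
  have B': "((F \<circ> real_of_ereal) \<longlongrightarrow> B) (at_left 1)"
    using B by (simp add: one_ereal_def ereal_tendsto_simps)
  have I: "einterval 0 1 = {0<..<1::real}"
    by (auto simp: einterval_def zero_ereal_def one_ereal_def)
  have *: "0 < (1::ereal)" by simp
  have integrable: "set_integrable lborel {0<..<1} f" and eq: "(LBINT x=0..1. f x) = B - A"
    using interval_integral_FTC_nonneg[OF * _ _ _ A' B', of f] der cont nonneg I
    by (auto simp: zero_ereal_def one_ereal_def)
  have "(\<integral>\<^sup>+x\<in>{0<..<1}. ennreal (f x) \<partial>lborel)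
      = (\<integral>\<^sup>+x. ennreal (indicator {0<..<1} x *\<^sub>R f x) \<partial>lborel)"
    by (intro nn_integral_cong) (simp split: split_indicator)
  also have "\<dots> = ennreal (\<integral>x. indicator {0<..<1} x *\<^sub>R f x \<partial>lborel)"
    using integrable nonneg unfolding set_integrable_def
    by (intro nn_integral_eq_integral) (auto split: split_indicator)
  also have "(\<integral>x. indicator {0<..<1} x *\<^sub>R f x \<partial>lborel) = B - A"
    using eq I by (simp add: interval_lebesgue_integral_def set_lebesgue_integral_def)
  finally show ?thesis .
qed

lemma nn_integral_suminf_unit_interval:
  fixes g :: "nat \<Rightarrow> real \<Rightarrow> ennreal"
  assumes "\<And>k. g k \<in> borel_measurable borel"
    and "\<And>x. 0 < x \<Longrightarrow> x < 1 \<Longrightarrow> f x = (\<Sum>k. g k x)"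
  shows "(\<integral>\<^sup>+x\<in>{0<..<1}. f x \<partial>lborel) = (\<Sum>k. \<integral>\<^sup>+x\<in>{0<..<1}. g k x \<partial>lborel)"
proof -
  have "(\<integral>\<^sup>+x\<in>{0<..<1}. f x \<partial>lborel) = (\<integral>\<^sup>+x. (\<Sum>k. g k x * indicator {0<..<1} x) \<partial>lborel)"
    using assms(2) by (intro nn_integral_cong) (simp split: split_indicator)
  also have "\<dots> = (\<Sum>k. \<integral>\<^sup>+x\<in>{0<..<1}. g k x \<partial>lborel)"
    using assms(1) by (intro nn_integral_suminf) auto
  finally show ?thesis .
qed

text \<open>
  The kernels integrated term by term below are expanded by this series. Its terms are nonnegative,
  so monotone convergence exchanges sum and integral.
\<close>
lemma geometric_ennreal_suminf:
  fixes c q :: real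
  assumes "0 \<le> c" "0 \<le> q" "q < 1"
  shows "ennreal (c / (1 - q)) = (\<Sum>k. ennreal (c * q ^ k))"
proof -
  have "(\<lambda>k. c * q ^ k) sums (c * (1 / (1 - q)))"
    using assms by (intro sums_mult geometric_sums) auto
  moreover have "0 \<le> c * q ^ k" for k
    using assms by simp
  ultimately have "(\<Sum>k. ennreal (c * q ^ k)) = ennreal (c * (1 / (1 - q)))"
    by (intro suminf_ennreal_eq)
  then show ?thesis
    by simp
qed

lemma nn_integral_power_unit_interval:
  assumes "0 \<le> c"
  shows "(\<integral>\<^sup>+x\<in>{0<..<1}. ennreal (c * x ^ k) \<partial>lborel) = ennreal (c / (k + 1))"
proof -
  define F where "F = (\<lambda>x::real. c * x ^ Suc k / (k + 1))"
  have cont: "isCont F x" for x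
    unfolding F_def by (intro continuous_intros) auto
  have "(F \<longlongrightarrow> 0) (at_right 0)" "(F \<longlongrightarrow> c / (k + 1)) (at_left 1)"
    using cont[of 0] cont[of 1] by (auto simp: isCont_def F_def filterlim_at_split)
  moreover have "(F has_real_derivative c * x ^ k) (at x)" for x
  proof -
    have "(F has_real_derivative c * (real (Suc k) * x ^ k) / (k + 1)) (at x)"
      using DERIV_pow[of "Suc k" x UNIV] unfolding F_def
      by (intro DERIV_cdivide DERIV_cmult) (simp del: power_Suc)
    then show ?thesis by (simp add: add_ac)
  qed
  ultimately have "(\<integral>\<^sup>+x\<in>{0<..<1}. ennreal (c * x ^ k) \<partial>lborel) = ennreal (c / (k + 1) - 0)"
    using assms by (intro nn_integral_FTC_unit_interval[of F]) (auto intro!: continuous_intros)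
  then show ?thesis by simp
qed

section \<open>Logarithmic moments\<close>

lemma nn_integral_log_moment:
  "(\<integral>\<^sup>+u\<in>{0<..<1}. ennreal (- ln u * u ^ k) \<partial>lborel) = ennreal (1 / (k + 1)\<^sup>2)"
proof -
  \<comment> \<open>The primitive from integration by parts, with one factor \<open>u\<close> moved to \<open>ln u\<close> so that both
    factors have a limit at \<open>0\<close>.\<close>
  define F where "F = (\<lambda>u::real. u ^ k * (u / (k + 1)\<^sup>2 - u * ln u / (k + 1)))"
  have der: "(F has_real_derivative (- ln x * x ^ k)) (at x)" if "0 < x" for x
  proof -
    have F: "F = (\<lambda>u::real. u ^ Suc k * (1 / (k + 1)\<^sup>2 - ln u / (k + 1)))"
      by (auto simp: F_def algebra_simps)
    define c where "c = real k + 1"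
    have c: "c > 0" "real (Suc k) = c" by (auto simp: c_def)
    have power: "((\<lambda>u. u ^ Suc k) has_real_derivative c * x ^ k) (at x)"
      using DERIV_pow[of "Suc k" x UNIV] by (simp add: c_def add_ac)
    have "((\<lambda>u::real. u ^ Suc k * (1 / c\<^sup>2 - ln u / c)) has_real_derivative
       c * x ^ k * (1 / c\<^sup>2 - ln x / c) + (0 - 1 / x / c) * x ^ Suc k) (at x)"
      using that c by (intro DERIV_mult power DERIV_diff DERIV_const DERIV_cdivide DERIV_ln_divide) auto
    also have "c * x ^ k * (1 / c\<^sup>2 - ln x / c) + (0 - 1 / x / c) * x ^ Suc k = - ln x * x ^ k"
      using that c by (simp add: field_simps power2_eq_square)
    finally show ?thesis unfolding F c_def by (simp add: add_ac)
  qed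
  have "((\<lambda>u::real. u / (k + 1)\<^sup>2 - u * ln u / (k + 1)) \<longlongrightarrow> 0) (at_right 0)"
    by real_asymp
  moreover have "((\<lambda>u::real. u ^ k) \<longlongrightarrow> 0 ^ k) (at_right 0)"
    by (intro tendsto_intros)
  ultimately have "(F \<longlongrightarrow> 0 ^ k * 0) (at_right 0)"
    unfolding F_def by (intro tendsto_mult)
  moreover have "isCont F 1"
    using der[of 1] DERIV_isCont by auto
  then have "(F \<longlongrightarrow> 1 / (k + 1)\<^sup>2) (at_left 1)"
    by (auto simp: isCont_def F_def filterlim_at_split)
  ultimately have "(\<integral>\<^sup>+u\<in>{0<..<1}. ennreal (- ln u * u ^ k) \<partial>lborel) = ennreal (1 / (k + 1)\<^sup>2 - 0 ^ k * 0)"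
    by (intro nn_integral_FTC_unit_interval[of F] der)
       (auto intro!: continuous_intros mult_nonpos_nonneg)
  then show ?thesis by (simp add: add_ac)
qed

lemma nn_integral_log_squared_moment:
  "(\<integral>\<^sup>+u\<in>{0<..<1}. ennreal ((ln u)\<^sup>2 * u ^ k) \<partial>lborel) = ennreal (2 / (k + 1) ^ 3)"
proof -
  define F where "F = (\<lambda>u::real. u ^ k * (u * (ln u)\<^sup>2 / (k + 1) - 2 * u * ln u / (k + 1)\<^sup>2 + 2 * u / (k + 1) ^ 3))"
  have der: "(F has_real_derivative ((ln x)\<^sup>2 * x ^ k)) (at x)" if "0 < x" for x
  proof -
    have F: "F = (\<lambda>u::real. u ^ Suc k * ((ln u)\<^sup>2 / (k + 1) - 2 * ln u / (k + 1)\<^sup>2 + 2 / (k + 1) ^ 3))"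
      by (auto simp: F_def algebra_simps)
    define c where "c = real k + 1"
    have c: "c > 0" "real (Suc k) = c" by (auto simp: c_def)
    have power: "((\<lambda>u. u ^ Suc k) has_real_derivative c * x ^ k) (at x)"
      using DERIV_pow[of "Suc k" x UNIV] by (simp add: c_def add_ac)
    have bracket: "((\<lambda>u. (ln u)\<^sup>2 / c - 2 * ln u / c\<^sup>2 + 2 / c ^ 3)
        has_real_derivative 2 * ln x / x / c - 2 / x / c\<^sup>2) (at x)"
    proof -
      have "((\<lambda>u. (ln u)\<^sup>2 / c - 2 * ln u / c\<^sup>2 + 2 / c ^ 3)
        has_real_derivative real 2 * ln x ^ (2 - Suc 0) * (1 / x) / c - 2 * (1 / x) / c\<^sup>2 + 0) (at x)"
        using that DERIV_pow[of 2 "ln x" UNIV]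
        by (intro DERIV_add DERIV_diff DERIV_cdivide DERIV_cmult DERIV_const DERIV_ln_divide
            DERIV_chain2[where f = "\<lambda>y. y\<^sup>2" and g = ln])
      then show ?thesis by simp
    qed
    have "((\<lambda>u::real. u ^ Suc k * ((ln u)\<^sup>2 / c - 2 * ln u / c\<^sup>2 + 2 / c ^ 3)) has_real_derivative
       c * x ^ k * ((ln x)\<^sup>2 / c - 2 * ln x / c\<^sup>2 + 2 / c ^ 3)
       + (2 * ln x / x / c - 2 / x / c\<^sup>2) * x ^ Suc k) (at x)"
      by (intro DERIV_mult power bracket)
    also have "c * x ^ k * ((ln x)\<^sup>2 / c - 2 * ln x / c\<^sup>2 + 2 / c ^ 3)
       + (2 * ln x / x / c - 2 / x / c\<^sup>2) * x ^ Suc k = (ln x)\<^sup>2 * x ^ k"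
      using that c by (simp add: field_simps power2_eq_square power3_eq_cube)
    finally show ?thesis unfolding F c_def by (simp add: add_ac)
  qed
  have "((\<lambda>u::real. u * (ln u)\<^sup>2 / (k + 1) - 2 * u * ln u / (k + 1)\<^sup>2 + 2 * u / (k + 1) ^ 3) \<longlongrightarrow> 0) (at_right 0)"
    by real_asymp
  moreover have "((\<lambda>u::real. u ^ k) \<longlongrightarrow> 0 ^ k) (at_right 0)"
    by (intro tendsto_intros)
  ultimately have "(F \<longlongrightarrow> 0 ^ k * 0) (at_right 0)"
    unfolding F_def by (intro tendsto_mult)
  moreover have "isCont F 1"
    using der[of 1] DERIV_isCont by auto
  then have "(F \<longlongrightarrow> 2 / (k + 1) ^ 3) (at_left 1)"
    by (auto simp: isCont_def F_def filterlim_at_split)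
  ultimately have "(\<integral>\<^sup>+u\<in>{0<..<1}. ennreal ((ln u)\<^sup>2 * u ^ k) \<partial>lborel) = ennreal (2 / (k + 1) ^ 3 - 0 ^ k * 0)"
    by (intro nn_integral_FTC_unit_interval[of F] der) (auto intro!: continuous_intros)
  then show ?thesis by (simp add: add_ac)
qed

text \<open>
  Harmonic numbers enter here. Integrate by parts with \<open>(1 - (1 - u) ^ Suc k) / (k + 1)\<close> as the
  primitive of \<open>(1 - u) ^ k\<close>: its zero at \<open>0\<close> cancels the singularity of
  \<open>ln u\<close>, and \<open>(1 - (1 - u) ^ Suc k) / u\<close> is a geometric sum \<open>S\<close> of powers of
  \<open>1 - u\<close>. The primitive \<open>- R\<close> of \<open>S\<close>, taken term by term, has a harmonic number as
  the value of \<open>R\<close> at \<open>0\<close>.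
\<close>
lemma nn_integral_log_reflected_moment:
  "(\<integral>\<^sup>+u\<in>{0<..<1}. ennreal (- ln u * (1 - u) ^ k) \<partial>lborel) = ennreal (harm (k + 1) / real (k + 1))"
proof -
  define S where "S = (\<lambda>u::real. \<Sum>j\<le>k. (1 - u) ^ j)"
  define R where "R = (\<lambda>u::real. \<Sum>j\<le>k. (1 - u) ^ Suc j / Suc j)"
  define F where "F = (\<lambda>u::real. (- (u * ln u) * S u - R u) / (k + 1))"
  have S: "u * S u = 1 - (1 - u) ^ Suc k" for u
    using one_diff_power_eq[of "1 - u" "Suc k"] by (simp add: S_def lessThan_Suc_atMost)
  have R: "(R has_real_derivative - S x) (at x)" for x
  proof -
    have "((\<lambda>u. (1 - u) ^ Suc j / Suc j) has_real_derivative - ((1 - x) ^ j)) (at x)" for j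
    proof -
      have "((\<lambda>u. (1 - u) ^ Suc j / Suc j) has_real_derivative
          (real (Suc j) * (1 - x) ^ j * (0 - 1)) / Suc j) (at x)"
        using DERIV_pow[of "Suc j" "1 - x" UNIV, unfolded diff_Suc_Suc diff_zero]
        by (intro DERIV_cdivide DERIV_chain2[where f = "\<lambda>y. y ^ Suc j" and g = "\<lambda>u. 1 - u"]
            DERIV_diff DERIV_const DERIV_ident)
      then show ?thesis by (simp del: of_nat_Suc)
    qed
    then show ?thesis
      unfolding R_def S_def sum_negf[symmetric] by (intro DERIV_sum) auto
  qed
  have F: "F = (\<lambda>u. (- ln u * (1 - (1 - u) ^ Suc k) - R u) / (k + 1))"
    by (auto simp: F_def S[symmetric] algebra_simps simp del: power_Suc)
  have der: "(F has_real_derivative (- ln x * (1 - x) ^ k)) (at x)" if "0 < x" for x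
  proof -
    have "((\<lambda>u. 1 - (1 - u) ^ Suc k) has_real_derivative
        0 - real (Suc k) * (1 - x) ^ k * (0 - 1)) (at x)"
      using DERIV_pow[of "Suc k" "1 - x" UNIV, unfolded diff_Suc_Suc diff_zero]
      by (intro DERIV_chain2[where f = "\<lambda>y. y ^ Suc k" and g = "\<lambda>u. 1 - u"]
          DERIV_diff DERIV_const DERIV_ident)
    from DERIV_mult[OF DERIV_minus[OF DERIV_ln_divide[OF that]] this]
    have "((\<lambda>u. (- ln u * (1 - (1 - u) ^ Suc k) - R u) / (k + 1)) has_real_derivative
       (- (1 / x) * (1 - (1 - x) ^ Suc k) + (0 - real (Suc k) * (1 - x) ^ k * (0 - 1)) * - ln x - - S x)
        / (k + 1)) (at x)"
      by (intro DERIV_cdivide DERIV_diff R)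
    also have "- (1 / x) * (1 - (1 - x) ^ Suc k) = - ((1 - (1 - x) ^ Suc k) / x)"
      by simp
    also have "(1 - (1 - x) ^ Suc k) / x = S x"
      using S[of x] that by (simp add: field_simps del: power_Suc)
    also have "(- S x + (0 - real (Suc k) * (1 - x) ^ k * (0 - 1)) * - ln x - - S x) / real (k + 1)
        = - ln x * (1 - x) ^ k"
      by simp
    finally show ?thesis unfolding F .
  qed
  have cont: "isCont S x" "isCont R x" for x
    unfolding S_def R_def by (intro continuous_intros; simp)+
  have "((\<lambda>u::real. - (u * ln u)) \<longlongrightarrow> 0) (at_right 0)"
    by real_asymp
  moreover have "(S \<longlongrightarrow> S 0) (at_right 0)" "(R \<longlongrightarrow> R 0) (at_right 0)"
    using cont[of 0] by (auto simp: isCont_def filterlim_at_split)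
  ultimately have "(F \<longlongrightarrow> (0 * S 0 - R 0) / (k + 1)) (at_right 0)"
    unfolding F_def by (intro tendsto_intros) simp_all
  moreover have "R 0 = harm (k + 1)"
    by (simp add: R_def harm_altdef lessThan_Suc_atMost inverse_eq_divide)
  moreover have "isCont F 1"
    using der[of 1] DERIV_isCont by auto
  then have "(F \<longlongrightarrow> 0) (at_left 1)"
    by (auto simp: isCont_def F_def R_def filterlim_at_split)
  ultimately have "(\<integral>\<^sup>+u\<in>{0<..<1}. ennreal (- ln u * (1 - u) ^ k) \<partial>lborel) = ennreal (0 - (0 * S 0 - harm (k + 1)) / (k + 1))"
    by (intro nn_integral_FTC_unit_interval[of F] der)
       (auto intro!: continuous_intros mult_nonpos_nonneg)
  then show ?thesis by (simp add: add_ac)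
qed

section \<open>A series of harmonic numbers\<close>

lemma harm_over_self_tendsto_0: "(\<lambda>n. harm n / real n) \<longlonglongrightarrow> 0"
proof -
  have "(\<lambda>n. (harm n - ln (real n)) * (1 / real n) + ln (real n) / real n) \<longlonglongrightarrow> euler_mascheroni * 0 + 0"
    by (intro tendsto_intros euler_mascheroni_LIMSEQ; real_asymp)
  then show ?thesis
    by (simp add: diff_divide_distrib)
qed

lemma reciprocal_difference_sums_harm:
  "(\<lambda>k. 1 / real (k + 1) - 1 / real (k + 1 + m)) sums harm m"
proof (induction m)
  case 0
  then show ?case by (simp add: harm_def)
next
  case (Suc m)
  have lim: "(\<lambda>k. 1 / real (k + 1 + m)) \<longlonglongrightarrow> 0" by real_asymp
  have "(\<lambda>k. 1 / real (k + 1 + m) - 1 / real (Suc k + 1 + m)) sums (1 / real (0 + 1 + m) - 0)"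
    using telescope_sums'[OF lim] by simp
  from sums_add[OF Suc this] show ?case
    by (simp add: harm_Suc inverse_eq_divide add_ac)
qed

text \<open>
  Summation by parts: differencing the harmonic numbers leaves \<open>1 / (k + 1)\<close>, and the boundary
  term vanishes because \<open>harm k\<close> grows more slowly than \<open>k\<close>.
\<close>
lemma harm_difference_sums:
  assumes "(\<lambda>k. 1 / (real (k + 1) * real (k + 1 + m))) sums s"
  shows "(\<lambda>k. harm (k + 1) * (1 / real (k + 1 + m) - 1 / real (k + 1 + Suc m))) sums s"
proof -
  let ?T = "\<lambda>k. harm k / real (k + 1 + m)"
  have lim: "?T \<longlonglongrightarrow> 0"
  proof -
    have "(\<lambda>k. harm k / real k * (real k / real (k + 1 + m))) \<longlonglongrightarrow> 0 * 1"
      by (intro tendsto_mult harm_over_self_tendsto_0) real_asymp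
    moreover have "harm k / real k * (real k / real (k + 1 + m)) = ?T k" for k
      by (cases "k = 0") (auto simp: harm_def)
    ultimately show ?thesis by simp
  qed
  have "(\<lambda>k. 1 / (real (k + 1) * real (k + 1 + m)) + (?T k - ?T (Suc k))) sums (s + (?T 0 - 0))"
    by (intro sums_add assms telescope_sums' lim)
  moreover have "1 / (real (k + 1) * real (k + 1 + m)) + (?T k - ?T (Suc k))
     = harm (k + 1) * (1 / real (k + 1 + m) - 1 / real (k + 1 + Suc m))" for k
  proof -
    have "1 / (real (k + 1) * real (k + 1 + m)) + harm k / real (k + 1 + m) = harm (k + 1) / real (k + 1 + m)"
    proof -
      have "1 / (a * b) + h / b = (h + inverse a) / b" if "a > 0" "b > 0" for a b h :: real
        using that by (simp add: field_simps)
      from this[of "real (k + 1)" "real (k + 1 + m)" "harm k"] show ?thesis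
        by (simp add: harm_Suc)
    qed
    then show ?thesis by (simp add: algebra_simps)
  qed
  ultimately show ?thesis by (simp add: harm_def)
qed

text \<open>
  Induction on \<open>n\<close>. Passing from \<open>n\<close> to \<open>n + 1\<close> adds the sum evaluated in
  \<open>harm_difference_sums\<close>, namely \<open>harm (n + 1) / (n + 1)\<close> by partial fractions, and this is
  exactly half the increment of \<open>harm\<^sup>2 + harm2\<close>. The start is Euler's \<open>\<zeta>(2)\<close>.
\<close>
lemma harm_Euler_sums:
  "(\<lambda>k. harm (k + 1) * (1 / real (k + 1) - 1 / real (k + 1 + Suc n)))
     sums (pi\<^sup>2 / 6 + ((harm n)\<^sup>2 + harm2 n) / 2)"
proof (induction n)
  case 0
  have "(\<lambda>k. 1 / (real (k + 1) * real (k + 1 + 0))) sums (pi\<^sup>2 / 6)"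
    using inverse_squares_sums by (simp only: power2_eq_square of_nat_mult add_0_right)
  from harm_difference_sums[OF this] show ?case
    by (simp add: harm_def harm2_def)
next
  case (Suc n)
  have "(\<lambda>k. (1 / real (k + 1) - 1 / real (k + 1 + Suc n)) / Suc n) sums (harm (Suc n) / Suc n)"
    by (intro sums_divide reciprocal_difference_sums_harm)
  then have "(\<lambda>k. 1 / (real (k + 1) * real (k + 1 + Suc n))) sums (harm (Suc n) / Suc n)"
  proof (rule back_subst[of "\<lambda>f. f sums (harm (Suc n) / Suc n)"])
    have "(1 / a - 1 / (a + b)) / b = 1 / (a * (a + b))" if "a > 0" "b > 0" for a b :: real
      using that by (simp add: divide_simps)
    from this[of "real (k + 1)" "real (Suc n)" for k]
    show "(\<lambda>k. (1 / real (k + 1) - 1 / real (k + 1 + Suc n)) / real (Suc n))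
        = (\<lambda>k. 1 / (real (k + 1) * real (k + 1 + Suc n)))"
      by (simp only: of_nat_add)
  qed
  from sums_add[OF Suc harm_difference_sums[OF this]]
  have "(\<lambda>k. harm (k + 1) * (1 / real (k + 1) - 1 / real (k + 1 + Suc (Suc n))))
     sums (pi\<^sup>2 / 6 + ((harm n)\<^sup>2 + harm2 n) / 2 + harm (Suc n) / Suc n)"
    by (simp add: algebra_simps)
  also have "pi\<^sup>2 / 6 + ((harm n)\<^sup>2 + harm2 n) / 2 + harm (Suc n) / Suc n
      = pi\<^sup>2 / 6 + ((harm (Suc n))\<^sup>2 + harm2 (Suc n)) / 2"
  proof -
    define c where "c = 1 / real (Suc n)"
    have step: "harm (Suc n) = harm n + c" "harm2 (Suc n) = harm2 n + c\<^sup>2"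
      by (simp_all add: harm_Suc harm2_def c_def inverse_eq_divide power_divide)
    have "harm (Suc n) / Suc n = harm (Suc n) * c"
      by (simp add: c_def)
    then have "pi\<^sup>2 / 6 + ((harm n)\<^sup>2 + harm2 n) / 2 + harm (Suc n) / Suc n
        = pi\<^sup>2 / 6 + ((harm n)\<^sup>2 + harm2 n) / 2 + (harm n + c) * c"
      by (simp only: step)
    also have "\<dots> = pi\<^sup>2 / 6 + ((harm n + c)\<^sup>2 + (harm2 n + c\<^sup>2)) / 2"
      by (simp add: power2_eq_square field_simps)
    finally show ?thesis
      by (simp only: step)
  qed
  finally show ?case .
qed

section \<open>Zeta values as integrals\<close>

text \<open>
  Expanding \<open>1 / (1 - u)\<close> sums all moments of \<open>w\<close> and gives \<open>c * Z\<close>. Expanding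
  \<open>u / (1 - u\<^sup>2)\<close> keeps the odd exponents, that is, the even denominators, so it gives
  \<open>c * Z / 2 ^ s\<close>. The two kernels of interest follow from
  \<open>1 / (1 + u) + 2 * u / (1 - u\<^sup>2) = 1 / (1 - u)\<close> and
  \<open>1 / (1 - u\<^sup>2) + u / (1 - u\<^sup>2) = 1 / (1 - u)\<close>. All terms of these identities are
  nonnegative, so no alternating series occurs.
\<close>
lemma nn_integral_moment_series:
  fixes w :: "real \<Rightarrow> real"
  assumes [measurable]: "w \<in> borel_measurable borel"
    and nonneg: "\<And>u. 0 < u \<Longrightarrow> u < 1 \<Longrightarrow> 0 \<le> w u"
    and moments: "\<And>k. (\<integral>\<^sup>+u\<in>{0<..<1}. ennreal (w u * u ^ k) \<partial>lborel) = ennreal (c / (real k + 1) ^ s)"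
    and "0 \<le> c"
    and Z: "(\<lambda>k. 1 / (real k + 1) ^ s) sums Z"
  shows "(\<integral>\<^sup>+u\<in>{0<..<1}. ennreal (w u / (1 + u)) \<partial>lborel) = ennreal (c * Z * (1 - 2 / 2 ^ s))"
    and "(\<integral>\<^sup>+u\<in>{0<..<1}. ennreal (w u / ((1 + u) * (1 - u))) \<partial>lborel) = ennreal (c * Z * (1 - 1 / 2 ^ s))"
proof -
  let ?I = "{0<..<1::real}"
  have cZ: "(\<lambda>k. c / (real k + 1) ^ s) sums (c * Z)"
    using sums_mult[OF Z, of c] by simp
  have odd: "(\<lambda>k. c / (real (2 * k + 1) + 1) ^ s) sums (c * Z / 2 ^ s)"
  proof -
    have "c / (real (2 * k + 1) + 1) ^ s = c / (real k + 1) ^ s / 2 ^ s" for k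
    proof -
      have "real (2 * k + 1) + 1 = 2 * (real k + 1)" by simp
      then show ?thesis by (simp only: power_mult_distrib) simp
    qed
    then show ?thesis using sums_divide[OF cZ, of "2 ^ s"] by (simp only:)
  qed
  have Z0: "0 \<le> c * Z"
    using sums_le[OF _ sums_zero cZ] \<open>0 \<le> c\<close> by simp
  have "(\<integral>\<^sup>+u\<in>?I. ennreal (w u / (1 - u)) \<partial>lborel)
      = (\<Sum>k. \<integral>\<^sup>+u\<in>?I. ennreal (w u * u ^ k) \<partial>lborel)"
    using nonneg by (intro nn_integral_suminf_unit_interval geometric_ennreal_suminf) auto
  also have "\<dots> = (\<Sum>k. ennreal (c / (real k + 1) ^ s))"
    by (simp only: moments)
  also have "\<dots> = ennreal (c * Z)"
    using \<open>0 \<le> c\<close> by (intro suminf_ennreal_eq cZ) auto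
  finally have all: "(\<integral>\<^sup>+u\<in>?I. ennreal (w u / (1 - u)) \<partial>lborel) = ennreal (c * Z)" .
  have "(\<integral>\<^sup>+u\<in>?I. ennreal (w u * u / (1 - u\<^sup>2)) \<partial>lborel)
      = (\<Sum>k. \<integral>\<^sup>+u\<in>?I. ennreal (w u * u * (u\<^sup>2) ^ k) \<partial>lborel)"
    using nonneg
    by (intro nn_integral_suminf_unit_interval geometric_ennreal_suminf)
       (auto simp: power_less_one_iff)
  also have "\<dots> = (\<Sum>k. \<integral>\<^sup>+u\<in>?I. ennreal (w u * u ^ (2 * k + 1)) \<partial>lborel)"
  proof -
    have "w u * u * (u\<^sup>2) ^ k = w u * u ^ (2 * k + 1)" for u k
      by (simp only: power_add power_one_right mult_ac flip: power_mult)
    then show ?thesis by (simp only:)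
  qed
  also have "\<dots> = (\<Sum>k. ennreal (c / (real (2 * k + 1) + 1) ^ s))"
    by (simp only: moments)
  also have "\<dots> = ennreal (c * Z / 2 ^ s)"
    using \<open>0 \<le> c\<close> by (intro suminf_ennreal_eq odd) auto
  finally have odd_part: "(\<integral>\<^sup>+u\<in>?I. ennreal (w u * u / (1 - u\<^sup>2)) \<partial>lborel) = ennreal (c * Z / 2 ^ s)" .
  have cancel: "X = ennreal (b - a)" if "X + ennreal a = ennreal b" "0 \<le> a" for X a b
    using that by (metis ennreal_minus ennreal_add_diff_cancel_right ennreal_neq_top)
  have "(\<integral>\<^sup>+u\<in>?I. ennreal (w u / (1 + u)) \<partial>lborel) + ennreal (2 * (c * Z / 2 ^ s))
      = (\<integral>\<^sup>+u\<in>?I. ennreal (w u / (1 + u)) \<partial>lborel)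
        + ennreal 2 * (\<integral>\<^sup>+u\<in>?I. ennreal (w u * u / (1 - u\<^sup>2)) \<partial>lborel)"
    unfolding odd_part by (subst ennreal_mult') simp_all
  also have "\<dots> = (\<integral>\<^sup>+u. ennreal (w u / (1 + u)) * indicator ?I u
      + ennreal 2 * (ennreal (w u * u / (1 - u\<^sup>2)) * indicator ?I u) \<partial>lborel)"
    by (simp add: nn_integral_add nn_integral_cmult)
  also have "\<dots> = (\<integral>\<^sup>+u\<in>?I. ennreal (w u / (1 - u)) \<partial>lborel)"
  proof (intro nn_integral_cong)
    fix u :: real
    have "ennreal (w u / (1 + u)) + ennreal 2 * ennreal (w u * u / (1 - u\<^sup>2)) = ennreal (w u / (1 - u))"
      if "0 < u" "u < 1"
    proof -
      have sq: "1 - u\<^sup>2 = (1 - u) * (1 + u)" by (simp add: power2_eq_square algebra_simps)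
      then have "w u / (1 + u) + 2 * (w u * u / (1 - u\<^sup>2)) = w u / (1 - u)"
        using that by (simp add: divide_simps) (simp add: algebra_simps)
      moreover have "0 \<le> w u * u / (1 - u\<^sup>2)"
        using nonneg that unfolding sq by simp
      moreover have "ennreal a + ennreal 2 * ennreal b = ennreal (a + 2 * b)"
        if "0 \<le> a" "0 \<le> b" for a b :: real
        using that by (subst ennreal_plus) (simp_all add: ennreal_mult')
      moreover have "0 \<le> w u / (1 + u)"
        using nonneg[OF that] that by simp
      ultimately show ?thesis by metis
    qed
    then show "ennreal (w u / (1 + u)) * indicator ?I u
      + ennreal 2 * (ennreal (w u * u / (1 - u\<^sup>2)) * indicator ?I u)
      = ennreal (w u / (1 - u)) * indicator ?I u"
      by (simp split: split_indicator)
  qed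
  also have "\<dots> = ennreal (c * Z)" by (fact all)
  finally have "(\<integral>\<^sup>+u\<in>?I. ennreal (w u / (1 + u)) \<partial>lborel) = ennreal (c * Z - 2 * (c * Z / 2 ^ s))"
    using Z0 by (intro cancel) auto
  then show "(\<integral>\<^sup>+u\<in>?I. ennreal (w u / (1 + u)) \<partial>lborel) = ennreal (c * Z * (1 - 2 / 2 ^ s))"
    by (simp add: algebra_simps)
  have "(\<integral>\<^sup>+u\<in>?I. ennreal (w u / ((1 + u) * (1 - u))) \<partial>lborel) + ennreal (c * Z / 2 ^ s)
      = (\<integral>\<^sup>+u. ennreal (w u / ((1 + u) * (1 - u))) * indicator ?I u
        + ennreal (w u * u / (1 - u\<^sup>2)) * indicator ?I u \<partial>lborel)"
    by (simp add: nn_integral_add flip: odd_part)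
  also have "\<dots> = (\<integral>\<^sup>+u\<in>?I. ennreal (w u / (1 - u)) \<partial>lborel)"
  proof (intro nn_integral_cong)
    fix u :: real
    have "ennreal (w u / ((1 + u) * (1 - u))) + ennreal (w u * u / (1 - u\<^sup>2)) = ennreal (w u / (1 - u))"
      if "0 < u" "u < 1"
    proof -
      have sq: "1 - u\<^sup>2 = (1 - u) * (1 + u)" by (simp add: power2_eq_square algebra_simps)
      then have "w u / ((1 + u) * (1 - u)) + w u * u / (1 - u\<^sup>2) = w u / (1 - u)"
        using that by (simp add: divide_simps) (simp add: algebra_simps)
      moreover have "0 \<le> w u * u / (1 - u\<^sup>2)"
        using nonneg that unfolding sq by simp
      ultimately show ?thesis
        using nonneg[OF that] that by (simp flip: ennreal_plus)
    qed
    then show "ennreal (w u / ((1 + u) * (1 - u))) * indicator ?I u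
      + ennreal (w u * u / (1 - u\<^sup>2)) * indicator ?I u
      = ennreal (w u / (1 - u)) * indicator ?I u"
      by (simp split: split_indicator)
  qed
  also have "\<dots> = ennreal (c * Z)" by (fact all)
  finally have "(\<integral>\<^sup>+u\<in>?I. ennreal (w u / ((1 + u) * (1 - u))) \<partial>lborel) = ennreal (c * Z - c * Z / 2 ^ s)"
    using Z0 by (intro cancel) auto
  then show "(\<integral>\<^sup>+u\<in>?I. ennreal (w u / ((1 + u) * (1 - u))) \<partial>lborel) = ennreal (c * Z * (1 - 1 / 2 ^ s))"
    by (simp add: algebra_simps)
qed

lemma nn_integral_log_over_1_plus:
  "(\<integral>\<^sup>+u\<in>{0<..<1}. ennreal (- ln u / (1 + u)) \<partial>lborel) = ennreal (pi\<^sup>2 / 12)"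
proof -
  have "(\<lambda>k. 1 / (real k + 1) ^ 2) sums (pi\<^sup>2 / 6)"
    using inverse_squares_sums by (simp add: add_ac)
  then have "(\<integral>\<^sup>+u\<in>{0<..<1}. ennreal (- ln u / (1 + u)) \<partial>lborel)
      = ennreal (1 * (pi\<^sup>2 / 6) * (1 - 2 / 2\<^sup>2))"
    by (intro nn_integral_moment_series(1)[where w = "\<lambda>u. - ln u"] nn_integral_log_moment) auto
  then show ?thesis by simp
qed

lemma zeta3_sums: "(\<lambda>k. 1 / (real k + 1) ^ 3) sums zeta3"
proof -
  have "summable (\<lambda>k. inverse (real (Suc k) ^ 3))"
    using inverse_power_summable[of 3] by (subst summable_Suc_iff) auto
  then show ?thesis
    by (simp add: zeta3_def summable_sums_iff inverse_eq_divide add_ac)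
qed

lemma nn_integral_log_squared_over_1_minus_square:
  "(\<integral>\<^sup>+u\<in>{0<..<1}. ennreal ((ln u)\<^sup>2 / ((1 + u) * (1 - u))) \<partial>lborel) = ennreal (7 / 4 * zeta3)"
  using nn_integral_moment_series(2)[OF _ _ _ _ zeta3_sums, of "\<lambda>u. (ln u)\<^sup>2" 2]
  by (simp add: nn_integral_log_squared_moment)

section \<open>The recursion for the double integral\<close>

text \<open>
  One twelfth of the mean value, as an integral over the unit square: here \<open>x\<close> is
  \<open>\<lambda>\<^sub>1 / (\<lambda>\<^sub>0 + \<lambda>\<^sub>1)\<close> and \<open>u\<close> is \<open>\<lambda>\<^sub>0 / (1 - \<lambda>\<^sub>1)\<close>. It takes values in the
  extended reals so that Tonelli's theorem applies before finiteness is known.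
\<close>
definition log_kernel_integral :: "nat \<Rightarrow> ennreal" where
  "log_kernel_integral n = (\<integral>\<^sup>+u\<in>{0<..<1}. (\<integral>\<^sup>+x\<in>{0<..<1}.
     ennreal (x ^ n * - ln u / ((1 + u) * (1 - x + x * u))) \<partial>lborel) \<partial>lborel)"

text \<open>
  Without the power of \<open>x\<close> the inner integral is elementary and produces a second logarithm.
\<close>
lemma log_kernel_integral_0: "log_kernel_integral 0 = ennreal (7 / 4 * zeta3)"
proof -
  have "(\<integral>\<^sup>+x\<in>{0<..<1}. ennreal (x ^ 0 * - ln u / ((1 + u) * (1 - x + x * u))) \<partial>lborel)
     = ennreal ((ln u)\<^sup>2 / ((1 + u) * (1 - u)))" if u: "0 < u" "u < 1" for u :: real
  proof -
    define F where "F = (\<lambda>x. ln u / ((1 + u) * (1 - u)) * ln (1 - x + x * u))"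
    have pos: "0 < 1 - x + x * u" if "0 \<le> x" "x \<le> 1" for x
    proof (cases "x = 1")
      case False
      then have "0 < 1 - x" using that by simp
      moreover have "0 \<le> x * u" using that u by simp
      ultimately show ?thesis by linarith
    qed (use u in simp)
    have der: "(F has_real_derivative x ^ 0 * - ln u / ((1 + u) * (1 - x + x * u))) (at x)"
      if "0 \<le> x" "x \<le> 1" for x
    proof -
      have "(F has_real_derivative ln u / ((1 + u) * (1 - u)) * (1 / (1 - x + x * u) * (0 - 1 + u))) (at x)"
      proof -
        have "((\<lambda>x. 1 - x + x * u) has_real_derivative 0 - 1 + u) (at x)"
          by (auto intro!: derivative_eq_intros)
        then show ?thesis
          unfolding F_def using pos[OF that]
          by (intro DERIV_cmult DERIV_chain2[where f = ln] DERIV_ln_divide)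
      qed
      also have "ln u / ((1 + u) * (1 - u)) * (1 / (1 - x + x * u) * (0 - 1 + u))
          = x ^ 0 * - ln u / ((1 + u) * (1 - x + x * u))"
      proof -
        have "l / (p * q) * (1 / d * - q) = - l / (p * d)" if "q \<noteq> 0" for l p q d :: real
          using that by simp
        from this[of "1 - u" "ln u" "1 + u" "1 - x + x * u"] u show ?thesis by simp
      qed
      finally show ?thesis .
    qed
    have "isCont F 0" "isCont F 1"
      using der[of 0] der[of 1] DERIV_isCont by auto
    then have "(F \<longlongrightarrow> F 0) (at_right 0)" "(F \<longlongrightarrow> F 1) (at_left 1)"
      by (auto simp: isCont_def filterlim_at_split)
    then have "(\<integral>\<^sup>+x\<in>{0<..<1}. ennreal (x ^ 0 * - ln u / ((1 + u) * (1 - x + x * u))) \<partial>lborel)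
       = ennreal (F 1 - F 0)"
    proof (intro nn_integral_FTC_unit_interval)
      fix x :: real assume x: "0 < x" "x < 1"
      show "isCont (\<lambda>x. x ^ 0 * - ln u / ((1 + u) * (1 - x + x * u))) x"
        using pos[of x] x u by (intro continuous_intros) auto
      show "0 \<le> x ^ 0 * - ln u / ((1 + u) * (1 - x + x * u))"
        using pos[of x] x u by (intro divide_nonneg_nonneg mult_nonneg_nonneg) auto
    next
      fix x :: real assume "0 < x" "x < 1"
      then show "(F has_real_derivative x ^ 0 * - ln u / ((1 + u) * (1 - x + x * u))) (at x)"
        by (intro der) auto
    qed auto
    then show ?thesis by (simp add: F_def power2_eq_square)
  qed
  then have "log_kernel_integral 0 = (\<integral>\<^sup>+u\<in>{0<..<1}. ennreal ((ln u)\<^sup>2 / ((1 + u) * (1 - u))) \<partial>lborel)"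
    unfolding log_kernel_integral_def by (intro nn_integral_cong) (simp split: split_indicator)
  then show ?thesis
    by (simp only: nn_integral_log_squared_over_1_minus_square)
qed

text \<open>
  The inhomogeneous term of the recursion. Expanding \<open>1 / (1 - x * (1 - u))\<close> separates the
  variables: in the \<open>k\<close>-th term the integral over \<open>x\<close> is \<open>1 / (k + n + 2)\<close>, and the
  one over \<open>u\<close> is \<open>harm (k + 1) / (k + 1)\<close>.
\<close>
lemma nn_integral_log_harm_kernel:
  "(\<integral>\<^sup>+u\<in>{0<..<1}. (\<integral>\<^sup>+x\<in>{0<..<1}. ennreal (x ^ Suc n * - ln u / (1 - x + x * u)) \<partial>lborel) \<partial>lborel)
    = ennreal ((pi\<^sup>2 / 6 + ((harm n)\<^sup>2 + harm2 n) / 2) / Suc n)"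
proof -
  let ?I = "{0<..<1::real}"
  have inner: "(\<integral>\<^sup>+x\<in>?I. ennreal (x ^ Suc n * - ln u / (1 - x + x * u)) \<partial>lborel)
      = (\<Sum>k. ennreal (1 / real (k + 1 + Suc n)) * ennreal (- ln u * (1 - u) ^ k))" if u: "0 < u" "u < 1" for u :: real
  proof -
    have "ennreal (x ^ Suc n * - ln u / (1 - x + x * u))
        = (\<Sum>k. ennreal (- ln u * (1 - u) ^ k * x ^ (k + Suc n)))" if x: "0 < x" "x < 1" for x :: real
    proof -
      have "x * (1 - u) < 1 * 1"
        using x u by (intro mult_strict_mono) auto
      then have "ennreal (x ^ Suc n * - ln u / (1 - x * (1 - u)))
          = (\<Sum>k. ennreal (x ^ Suc n * - ln u * (x * (1 - u)) ^ k))"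
        using x u by (intro geometric_ennreal_suminf) (auto intro!: mult_nonneg_nonpos)
      moreover have "1 - x * (1 - u) = 1 - x + x * u"
        by (simp add: algebra_simps)
      moreover have "x ^ Suc n * - ln u * (x * (1 - u)) ^ k = - ln u * (1 - u) ^ k * x ^ (k + Suc n)" for k
        by (simp add: power_mult_distrib power_add)
      ultimately show ?thesis by (simp only:)
    qed
    then have "(\<integral>\<^sup>+x\<in>?I. ennreal (x ^ Suc n * - ln u / (1 - x + x * u)) \<partial>lborel)
        = (\<Sum>k. \<integral>\<^sup>+x\<in>?I. ennreal (- ln u * (1 - u) ^ k * x ^ (k + Suc n)) \<partial>lborel)"
      by (intro nn_integral_suminf_unit_interval) auto
    also have "\<dots> = (\<Sum>k. ennreal (- ln u * (1 - u) ^ k / real (k + Suc n + 1)))"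
    proof (intro suminf_cong nn_integral_power_unit_interval)
      show "0 \<le> - ln u * (1 - u) ^ k" for k
        using u by (intro mult_nonneg_nonneg) auto
    qed
    also have "\<dots> = (\<Sum>k. ennreal (1 / real (k + 1 + Suc n)) * ennreal (- ln u * (1 - u) ^ k))"
      using u by (intro suminf_cong) (simp flip: ennreal_mult' add: add_ac)
    finally show ?thesis .
  qed
  have "(\<integral>\<^sup>+u\<in>?I. (\<integral>\<^sup>+x\<in>?I. ennreal (x ^ Suc n * - ln u / (1 - x + x * u)) \<partial>lborel) \<partial>lborel)
     = (\<Sum>k. \<integral>\<^sup>+u\<in>?I. ennreal (1 / real (k + 1 + Suc n)) * ennreal (- ln u * (1 - u) ^ k) \<partial>lborel)"
    by (intro nn_integral_suminf_unit_interval inner) auto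
  also have "\<dots> = (\<Sum>k. ennreal (1 / real (k + 1 + Suc n)) * ennreal (harm (k + 1) / real (k + 1)))"
    by (intro suminf_cong)
      (subst mult.assoc, subst nn_integral_cmult, simp, simp only: nn_integral_log_reflected_moment of_nat_add of_nat_1)
  also have "\<dots> = (\<Sum>k. ennreal (harm (k + 1) * (1 / real (k + 1) - 1 / real (k + 1 + Suc n)) / Suc n))"
  proof (intro suminf_cong)
    fix k
    have "1 / (a + b) * (h / a) = h * (1 / a - 1 / (a + b)) / b" if "a > 0" "b > 0" for a b h :: real
      using that by (simp add: divide_simps)
    from this[of "real (k + 1)" "real (Suc n)" "harm (k + 1)"]
    show "ennreal (1 / real (k + 1 + Suc n)) * ennreal (harm (k + 1) / real (k + 1))
        = ennreal (harm (k + 1) * (1 / real (k + 1) - 1 / real (k + 1 + Suc n)) / Suc n)"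
      by (simp only: of_nat_add flip: ennreal_mult')
        (simp flip: ennreal_mult' add: harm_nonneg)
  qed
  also have "\<dots> = ennreal ((pi\<^sup>2 / 6 + ((harm n)\<^sup>2 + harm2 n) / 2) / Suc n)"
    by (intro suminf_ennreal_eq sums_divide harm_Euler_sums divide_nonneg_nonneg mult_nonneg_nonneg harm_nonneg)
      (simp_all add: frac_le)
  finally show ?thesis .
qed

text \<open>
  With \<open>D = 1 - x + x * u\<close> one has \<open>2 * x + D = 1 + x * (1 + u)\<close>, so the factor
  \<open>2 * x - 1\<close> of \<open>2 * x ^ Suc n - x ^ n\<close> turns the kernel \<open>1 / ((1 + u) * D)\<close> into
  \<open>x / D - 1 / (1 + u)\<close>. The negative terms are moved to the other side, which leaves
  nonnegative integrands everywhere and makes additivity of the nonnegative integral applicable.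
\<close>
lemma log_kernel_integral_Suc:
  "2 * log_kernel_integral (Suc n) + ennreal (pi\<^sup>2 / 12 / Suc n)
    = log_kernel_integral n + ennreal ((pi\<^sup>2 / 6 + ((harm n)\<^sup>2 + harm2 n) / 2) / Suc n)"
proof -
  let ?I = "{0<..<1::real}"
  let ?f = "\<lambda>n u x. ennreal (x ^ n * - ln u / ((1 + u) * (1 - x + x * u)))"
  let ?g = "\<lambda>u x. ennreal (- ln u / (1 + u) * x ^ n)"
  let ?h = "\<lambda>u x. ennreal (x ^ Suc n * - ln u / (1 - x + x * u))"
  have pointwise: "2 * ?f (Suc n) u x + ?g u x = ?f n u x + ?h u x"
    if "0 < u" "u < 1" "0 < x" "x < 1" for u x :: real
  proof -
    have D: "0 < 1 - x + x * u" using that by (intro add_pos_pos) auto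
    define w where "w = - ln u"
    have w: "0 \<le> w" using that by (simp add: w_def)
    have "2 * (x ^ Suc n * w / ((1 + u) * (1 - x + x * u))) + w / (1 + u) * x ^ n
        = x ^ n * w / ((1 + u) * (1 - x + x * u)) + x ^ Suc n * w / (1 - x + x * u)"
      using D that by (simp add: divide_simps) (simp add: algebra_simps)
    then show ?thesis
      unfolding w_def[symmetric]
      using D that w
      by (simp del: power_Suc flip: ennreal_plus ennreal_mult' ennreal_numeral add: ennreal_mult'[symmetric])
  qed
  have [measurable]: "(\<lambda>(u, x). ?f m u x * indicator ?I x) \<in> borel_measurable (borel \<Otimes>\<^sub>M borel)"
    "(\<lambda>(u, x). ?g u x * indicator ?I x) \<in> borel_measurable (borel \<Otimes>\<^sub>M borel)"
    "(\<lambda>(u, x). ?h u x * indicator ?I x) \<in> borel_measurable (borel \<Otimes>\<^sub>M borel)" for m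
    by measurable
  have g: "(\<integral>\<^sup>+u\<in>?I. (\<integral>\<^sup>+x\<in>?I. ?g u x \<partial>lborel) \<partial>lborel) = ennreal (pi\<^sup>2 / 12 / Suc n)"
  proof -
    have "(\<integral>\<^sup>+u\<in>?I. (\<integral>\<^sup>+x\<in>?I. ?g u x \<partial>lborel) \<partial>lborel)
       = (\<integral>\<^sup>+u. (ennreal (- ln u / (1 + u)) * indicator ?I u) * ennreal (1 / Suc n) \<partial>lborel)"
    proof (intro nn_integral_cong)
      fix u :: real
      have "(\<integral>\<^sup>+x\<in>?I. ?g u x \<partial>lborel) = ennreal (- ln u / (1 + u)) * ennreal (1 / Suc n)"
        if "0 < u" "u < 1"
      proof -
        have "0 \<le> - ln u / (1 + u)"
          using that by (intro divide_nonneg_nonneg) auto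
        moreover from this have "ennreal (- ln u / (1 + u) / (n + 1))
            = ennreal (- ln u / (1 + u)) * ennreal (1 / Suc n)"
          by (subst ennreal_mult'[symmetric]) (simp_all add: add_ac)
        ultimately show ?thesis
          by (simp only: nn_integral_power_unit_interval)
      qed
      then show "(\<integral>\<^sup>+x\<in>?I. ?g u x \<partial>lborel) * indicator ?I u
          = (ennreal (- ln u / (1 + u)) * indicator ?I u) * ennreal (1 / Suc n)"
        by (simp split: split_indicator)
    qed
    also have "\<dots> = ennreal (pi\<^sup>2 / 12) * ennreal (1 / Suc n)"
      by (subst nn_integral_multc) (simp, simp only: nn_integral_log_over_1_plus)
    finally show ?thesis by (simp flip: ennreal_mult')
  qed
  have "2 * log_kernel_integral (Suc n) + ennreal (pi\<^sup>2 / 12 / Suc n)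
      = (\<integral>\<^sup>+u. (\<integral>\<^sup>+x. (2 * (?f (Suc n) u x * indicator ?I x) + ?g u x * indicator ?I x) \<partial>lborel) * indicator ?I u \<partial>lborel)"
    unfolding log_kernel_integral_def g[symmetric]
    by (simp add: nn_integral_add nn_integral_cmult distrib_right mult.assoc del: power_Suc)
  also have "\<dots> = (\<integral>\<^sup>+u. (\<integral>\<^sup>+x. (?f n u x * indicator ?I x + ?h u x * indicator ?I x) \<partial>lborel) * indicator ?I u \<partial>lborel)"
  proof (intro nn_integral_cong)
    fix u :: real
    have "2 * (?f (Suc n) u x * indicator ?I x) + ?g u x * indicator ?I x
        = ?f n u x * indicator ?I x + ?h u x * indicator ?I x" if "u \<in> ?I" for x
      using pointwise[of u x] that by (simp del: power_Suc split: split_indicator)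
    then show "(\<integral>\<^sup>+x. (2 * (?f (Suc n) u x * indicator ?I x) + ?g u x * indicator ?I x) \<partial>lborel) * indicator ?I u
       = (\<integral>\<^sup>+x. (?f n u x * indicator ?I x + ?h u x * indicator ?I x) \<partial>lborel) * indicator ?I u"
      by (cases "u \<in> ?I") (simp_all del: power_Suc)
  qed
  also have "\<dots> = log_kernel_integral n
      + ennreal ((pi\<^sup>2 / 6 + ((harm n)\<^sup>2 + harm2 n) / 2) / Suc n)"
    unfolding log_kernel_integral_def nn_integral_log_harm_kernel[symmetric]
    by (simp add: nn_integral_add distrib_right del: power_Suc)
  finally show ?thesis .
qed

lemma log_kernel_integral_finite: "log_kernel_integral n < top"
proof (induction n)
  case (Suc n)
  then have "2 * log_kernel_integral (Suc n) + ennreal (pi\<^sup>2 / 12 / Suc n) < top"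
    unfolding log_kernel_integral_Suc by (simp add: ennreal_less_top)
  then show ?case
    by (auto simp: ennreal_mult_less_top)
qed (simp add: log_kernel_integral_0)

text \<open>
  The recursion reads \<open>12 * J (n + 1) = 6 * J n + \<dots>\<close>, so the initial value is halved at each step
  and the inhomogeneous terms accumulate with weights \<open>2 ^ m / 2 ^ n\<close>. The two contributions
  \<open>\<pi>\<^sup>2 / 6\<close> and \<open>- \<pi>\<^sup>2 / 12\<close> combine into the single sum with factor
  \<open>\<pi>\<^sup>2\<close>.
\<close>
lemma log_kernel_integral_closed_form:
  "12 * enn2real (log_kernel_integral n) =
     21 / 2 ^ n * zeta3
     + pi ^ 2 / 2 ^ n * (\<Sum>m=1..n. 2 ^ (m - 1) / real m)
     + 3 / 2 ^ n * (\<Sum>m=1..n. 2 ^ m / real m * (harm (m - 1) ^ 2 + harm2 (m - 1)))"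
proof (induction n)
  case 0
  have "0 \<le> zeta3"
    using sums_le[OF _ sums_zero zeta3_sums] by simp
  then show ?case by (simp add: log_kernel_integral_0)
next
  case (Suc n)
  define J where "J = (\<lambda>n. enn2real (log_kernel_integral n))"
  have J: "log_kernel_integral m = ennreal (J m)" "0 \<le> J m" for m
    using log_kernel_integral_finite[of m] by (simp_all add: J_def)
  define h where "h = (harm n)\<^sup>2 + harm2 n"
  have "0 \<le> h" by (simp add: h_def harm2_def sum_nonneg)
  have "ennreal (2 * J (Suc n) + pi\<^sup>2 / 12 / Suc n)
      = ennreal (J n + (pi\<^sup>2 / 6 + h / 2) / Suc n)"
    using log_kernel_integral_Suc[of n] J(2) \<open>0 \<le> h\<close> unfolding J(1) h_def[symmetric]
    by (simp add: ennreal_mult')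
  then have "2 * J (Suc n) + pi\<^sup>2 / 12 / Suc n = J n + (pi\<^sup>2 / 6 + h / 2) / Suc n"
    using J(2) \<open>0 \<le> h\<close> by (subst (asm) ennreal_inj) auto
  then have rec: "12 * enn2real (log_kernel_integral (Suc n))
      = 12 * enn2real (log_kernel_integral n) / 2 + pi\<^sup>2 / (2 * real (Suc n)) + 3 * h / real (Suc n)"
    unfolding J_def by (simp add: divide_simps) (simp add: algebra_simps)
  define A B where "A = (\<Sum>m=1..n. 2 ^ (m - 1) / real m)"
    and "B = (\<Sum>m=1..n. 2 ^ m / real m * (harm (m - 1) ^ 2 + harm2 (m - 1)))"
  have sums: "(\<Sum>m=1..Suc n. 2 ^ (m - 1) / real m) = A + 2 ^ n / real (Suc n)"
    "(\<Sum>m=1..Suc n. 2 ^ m / real m * (harm (m - 1) ^ 2 + harm2 (m - 1))) = B + 2 ^ Suc n / real (Suc n) * h"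
    by (simp_all add: A_def B_def h_def)
  have IH: "12 * enn2real (log_kernel_integral n) = 21 / 2 ^ n * zeta3 + pi\<^sup>2 / 2 ^ n * A + 3 / 2 ^ n * B"
    using Suc by (simp only: A_def B_def)
  have *: "x / 2 ^ Suc n * (S + 2 ^ n / y) = x / 2 ^ n * S / 2 + x / (2 * y)"
       "z / 2 ^ Suc n * (S + 2 ^ Suc n / y * h) = z / 2 ^ n * S / 2 + z * h / y" for x y z S :: real
    by (simp_all add: field_simps)
  show ?case
    unfolding rec IH sums * by (simp add: add_divide_distrib)
qed

section \<open>Reduction to the standard simplex\<close>

lemma nn_integral_vector_3:
  fixes f :: "real ^ 3 \<Rightarrow> ennreal"
  assumes [measurable]: "f \<in> borel_measurable borel"
  shows "(\<integral>\<^sup>+y. f y \<partial>lborel) = (\<integral>\<^sup>+a. \<integral>\<^sup>+b. \<integral>\<^sup>+c. f (vector [a, b, c]) \<partial>lborel \<partial>lborel \<partial>lborel)"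
proof -
  let ?M = "lborel \<Otimes>\<^sub>M (lborel \<Otimes>\<^sub>M lborel) :: (real \<times> real \<times> real) measure"
  define \<phi> where "\<phi> = (\<lambda>(a, b, c). vector [a, b, c] :: real ^ 3)"
  have "\<phi> = (\<lambda>z. fst z *\<^sub>R axis 1 1 + fst (snd z) *\<^sub>R axis 2 1 + snd (snd z) *\<^sub>R axis 3 1)"
    by (auto simp: \<phi>_def vec_eq_iff forall_3 axis_def vector_3)
  then have meas [measurable]: "\<phi> \<in> borel_measurable ?M"
    by simp
  have plane: "sigma_finite_measure (lborel \<Otimes>\<^sub>M lborel :: (real \<times> real) measure)"
    unfolding lborel_prod by (rule sigma_finite_lborel)
  have "lborel = distr ?M borel \<phi>"
  proof (rule lborel_eqI)
    fix l u :: "real ^ 3"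
    assume le: "\<And>b. b \<in> Basis \<Longrightarrow> l \<bullet> b \<le> u \<bullet> b"
    have le': "l $ i \<le> u $ i" for i
      using le[of "axis i 1"] by (simp add: cart_eq_inner_axis)
    have box: "\<phi> -` box l u \<inter> space ?M = {l $ 1<..<u $ 1} \<times> ({l $ 2<..<u $ 2} \<times> {l $ 3<..<u $ 3})"
      by (auto simp: \<phi>_def mem_box_cart forall_3 vector_3 space_pair_measure)
    have "emeasure (distr ?M borel \<phi>) (box l u) = emeasure ?M (\<phi> -` box l u \<inter> space ?M)"
      by (intro emeasure_distr meas) simp
    also have "\<dots> = ennreal (u $ 1 - l $ 1) * (ennreal (u $ 2 - l $ 2) * ennreal (u $ 3 - l $ 3))"
    proof -
      have "emeasure ?M ({l $ 1<..<u $ 1} \<times> ({l $ 2<..<u $ 2} \<times> {l $ 3<..<u $ 3}))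
        = emeasure lborel {l $ 1<..<u $ 1} * emeasure (lborel \<Otimes>\<^sub>M lborel) ({l $ 2<..<u $ 2} \<times> {l $ 3<..<u $ 3})"
        by (intro sigma_finite_measure.emeasure_pair_measure_Times[OF plane] pair_measureI)
          (simp_all only: sets_lborel borel_open open_greaterThanLessThan)
      also have "emeasure (lborel \<Otimes>\<^sub>M lborel) ({l $ 2<..<u $ 2} \<times> {l $ 3<..<u $ 3})
        = emeasure lborel {l $ 2<..<u $ 2} * emeasure lborel {l $ 3<..<u $ 3}"
        by (intro lborel.emeasure_pair_measure_Times)
          (simp_all only: sets_lborel borel_open open_greaterThanLessThan)
      finally show ?thesis
        by (simp only: box emeasure_lborel_Ioo[OF le'])
    qed
    also have "\<dots> = ennreal (\<Prod>i\<in>UNIV. u $ i - l $ i)"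
    proof -
      have "prod f (UNIV :: 3 set) = f 1 * (f 2 * f 3)" for f :: "3 \<Rightarrow> real"
        unfolding UNIV_3 by simp
      then show ?thesis
        by (simp only: ennreal_mult diff_ge_0_iff_ge le' mult_nonneg_nonneg)
    qed
    also have "(\<Prod>i\<in>UNIV. u $ i - l $ i) = (\<Prod>b\<in>(\<lambda>i. axis i 1) ` UNIV. (u - l) \<bullet> b)"
      by (subst prod.reindex) (auto simp: inj_on_def axis_eq_axis inner_axis)
    also have "(\<lambda>i. axis i 1) ` UNIV = (Basis :: (real ^ 3) set)"
      by (auto simp: Basis_vec_def)
    finally show "emeasure (distr ?M borel \<phi>) (box l u) = ennreal (\<Prod>b\<in>Basis. (u - l) \<bullet> b)" .
  qed simp
  then have "(\<integral>\<^sup>+y. f y \<partial>lborel) = (\<integral>\<^sup>+y. f y \<partial>distr ?M borel \<phi>)"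
    by simp
  also have "\<dots> = (\<integral>\<^sup>+z. f (\<phi> z) \<partial>?M)"
    by (intro nn_integral_distr) auto
  also have "\<dots> = (\<integral>\<^sup>+a. \<integral>\<^sup>+w. f (\<phi> (a, w)) \<partial>(lborel \<Otimes>\<^sub>M lborel) \<partial>lborel)"
    by (intro sigma_finite_measure.nn_integral_fst[OF plane, symmetric]) measurable
  also have "\<dots> = (\<integral>\<^sup>+a. \<integral>\<^sup>+b. \<integral>\<^sup>+c. f (\<phi> (a, b, c)) \<partial>lborel \<partial>lborel \<partial>lborel)"
    by (intro nn_integral_cong lborel.nn_integral_fst[symmetric]) measurable
  finally show ?thesis by (simp add: \<phi>_def)
qed

text \<open>
  The mean value does not depend on the tetrahedron: the Jacobian determinant of the affine map
  scales the integral and the volume alike.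
\<close>
lemma mean_value_affine_image:
  fixes L :: "real ^ 3 \<Rightarrow> real ^ 3"
  assumes "linear L" "inj L" and S: "S \<in> lmeasurable"
    and f: "(\<lambda>y. f (L y + c)) absolutely_integrable_on S"
  shows "mean_value ((\<lambda>y. L y + c) ` S) f = mean_value S (\<lambda>y. f (L y + c))"
proof -
  let ?g = "\<lambda>y. L y + c"
  define d where "d = \<bar>det (matrix L)\<bar>"
  have "d \<noteq> 0"
    using assms(1,2) by (simp add: d_def det_nz_iff_inj)
  have transform: "h absolutely_integrable_on (?g ` S) \<and> integral (?g ` S) h = d * integral S (\<lambda>y. h (?g y))"
    if h: "(\<lambda>y. h (?g y)) absolutely_integrable_on S" for h :: "real ^ 3 \<Rightarrow> real"
  proof -
    have "(\<lambda>y. d *\<^sub>R vec (h (?g y)) :: real ^ 1) absolutely_integrable_on S \<and>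
           integral S (\<lambda>y. d *\<^sub>R vec (h (?g y))) = (vec (d * integral S (\<lambda>y. h (?g y))) :: real ^ 1)
         \<longleftrightarrow> (\<lambda>x. vec (h x) :: real ^ 1) absolutely_integrable_on (?g ` S) \<and>
           integral (?g ` S) (\<lambda>x. vec (h x)) = (vec (d * integral S (\<lambda>y. h (?g y))) :: real ^ 1)"
      unfolding d_def
    proof (intro has_absolute_integral_change_of_variables)
      show "S \<in> sets lebesgue" using S by auto
      show "(?g has_derivative L) (at y within S)" for y
        using linear_imp_has_derivative[OF \<open>linear L\<close>]
        by (intro has_derivative_add_const)
      show "inj_on ?g S"
        using \<open>inj L\<close> by (auto simp: inj_on_def)
    qed
    then show ?thesis
      using h by (simp add: absolutely_integrable_on_1_iff integral_on_1_eq vec_eq_iff)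
  qed
  have "(\<lambda>y. 1 :: real) absolutely_integrable_on S"
    using S by (simp add: absolutely_integrable_on_const)
  then have one: "(\<lambda>y. 1 :: real) absolutely_integrable_on (?g ` S) \<and> integral (?g ` S) (\<lambda>y. 1) = d * integral S (\<lambda>y. 1 :: real)"
    by (intro transform)
  have "?g ` S = (\<lambda>x. c + x) ` (L ` S)"
    by (auto simp: add.commute)
  then have "?g ` S \<in> lmeasurable"
    using measurable_linear_image[OF \<open>linear L\<close> S] measurable_translation by metis
  then have "measure lebesgue (?g ` S) = d * measure lebesgue S"
    using one S by (simp add: lmeasure_integral)
  moreover have "(LINT x:?g ` S|lebesgue. f x) = d * (LINT y:S|lebesgue. f (?g y))"
    using transform[OF f] f by (simp add: set_lebesgue_integral_eq_integral(2))
  ultimately show ?thesis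
    using \<open>d \<noteq> 0\<close> by (simp add: mean_value_def)
qed

text \<open>
  Barycentric coordinates in terms of a point of the standard simplex. The components of \<open>y\<close> are
  \<open>\<lambda>\<^sub>1\<close>, \<open>\<lambda>\<^sub>0\<close>, \<open>\<lambda>\<^sub>2\<close> in this order, which is the order, from the outside in, of the
  iterated integral below.
\<close>
definition simplex_coords :: "real ^ 3 \<Rightarrow> nat \<Rightarrow> real" where
  "simplex_coords y i = (if i = 0 then y $ 2 else if i = 1 then y $ 1 else if i = 2 then y $ 3
     else if i = 3 then 1 - y $ 1 - y $ 2 - y $ 3 else 0)"

definition edge_map :: "(nat \<Rightarrow> real ^ 3) \<Rightarrow> real ^ 3 \<Rightarrow> real ^ 3" where
  "edge_map v y = y $ 2 *\<^sub>R (v 0 - v 3) + y $ 1 *\<^sub>R (v 1 - v 3) + y $ 3 *\<^sub>R (v 2 - v 3)"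

lemma sum_upto_3: "(\<Sum>j\<le>3. f j) = f 0 + f 1 + f 2 + f (3::nat)"
  by (simp add: eval_nat_numeral)

lemma linear_edge_map: "linear (edge_map v)"
  by (intro linearI) (simp_all add: edge_map_def algebra_simps)

lemma affinely_independent_vertices:
  assumes "tetrahedron_vertices v" "(\<Sum>j\<le>3. c j) = 0" "(\<Sum>j\<le>3. c j *\<^sub>R v j) = 0" "i \<le> 3"
  shows "c i = (0::real)"
proof (rule ccontr)
  assume "c i \<noteq> 0"
  have inj: "inj_on v {..3}" and indep: "\<not> affine_dependent (v ` {..3})"
    using assms(1) by (auto simp: tetrahedron_vertices_def)
  define U where "U = (\<lambda>x. c (inv_into {..3} v x))"
  have U: "U (v j) = c j" if "j \<le> 3" for j
    using that inj by (simp add: U_def inv_into_f_f)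
  have "sum U (v ` {..3}) = 0" "(\<Sum>x\<in>v ` {..3}. U x *\<^sub>R x) = 0"
    using assms(2,3) by (simp_all add: sum.reindex[OF inj] U)
  moreover have "\<exists>x\<in>v ` {..3}. U x \<noteq> 0"
    using U[OF assms(4)] assms(4) \<open>c i \<noteq> 0\<close> by (intro bexI[of _ "v i"]) auto
  ultimately have "affine_dependent (v ` {..3})"
    by (subst affine_dependent_explicit_finite) auto
  with indep show False ..
qed

lemma inj_edge_map:
  assumes "tetrahedron_vertices v"
  shows "inj (edge_map v)"
proof (subst linear_injective_0[OF linear_edge_map], intro allI impI)
  fix y assume y: "edge_map v y = 0"
  define c where "c = (\<lambda>i::nat. if i = 0 then y $ 2 else if i = 1 then y $ 1 else if i = 2 then y $ 3
     else - y $ 1 - y $ 2 - y $ 3)"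
  have c_sum: "(\<Sum>j\<le>3. c j) = 0"
    by (simp add: sum_upto_3 c_def)
  have "(\<Sum>j\<le>3. c j *\<^sub>R v j) = edge_map v y"
    by (simp add: sum_upto_3 c_def edge_map_def scaleR_left_diff_distrib scaleR_right_diff_distrib)
  then have c_comb: "(\<Sum>j\<le>3. c j *\<^sub>R v j) = 0"
    by (simp only: y)
  have "c 0 = 0" "c 1 = 0" "c 2 = 0"
    by (rule affinely_independent_vertices[OF assms c_sum c_comb]; simp)+
  then show "y = 0"
    by (simp add: vec_eq_iff forall_3 c_def)
qed

text \<open>
  The definite description defining the barycentric coordinates denotes because the coefficients
  are unique, and this is affine independence of the vertices.
\<close>
lemma barycentric_affine:
  assumes "tetrahedron_vertices v"
  shows "barycentric v i (edge_map v y + v 3) = simplex_coords y i"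
proof -
  have "(THE c. (\<Sum>j\<le>3. c j) = 1 \<and> (\<Sum>j\<le>3. c j *\<^sub>R v j) = edge_map v y + v 3 \<and> (\<forall>j>3. c j = 0))
      = simplex_coords y"
  proof (rule the_equality)
    show *: "(\<Sum>j\<le>3. simplex_coords y j) = 1 \<and> (\<Sum>j\<le>3. simplex_coords y j *\<^sub>R v j) = edge_map v y + v 3
        \<and> (\<forall>j>3. simplex_coords y j = 0)"
      by (simp add: sum_upto_3 simplex_coords_def edge_map_def
          scaleR_left_diff_distrib scaleR_right_diff_distrib)
    fix c :: "nat \<Rightarrow> real"
    assume c: "(\<Sum>j\<le>3. c j) = 1 \<and> (\<Sum>j\<le>3. c j *\<^sub>R v j) = edge_map v y + v 3 \<and> (\<forall>j>3. c j = 0)"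
    have "(\<Sum>j\<le>3. c j - simplex_coords y j) = 0"
      using c * by (simp only: sum_subtractf diff_self)
    moreover have "(\<Sum>j\<le>3. (c j - simplex_coords y j) *\<^sub>R v j) = 0"
      using c * by (simp only: sum_subtractf scaleR_left_diff_distrib diff_self)
    ultimately have "c j - simplex_coords y j = 0" if "j \<le> 3" for j
      using that by (rule affinely_independent_vertices[OF assms])
    moreover have "c j = simplex_coords y j" if "3 < j" for j
      using c * that by simp
    ultimately show "c = simplex_coords y"
      by (metis eq_iff_diff_eq_0 ext not_le)
  qed
  then show ?thesis by (simp add: barycentric_def)
qed

lemma Basis_real_3: "(Basis :: (real ^ 3) set) = {axis 1 1, axis 2 1, axis 3 1}"
proof -
  have "(Basis :: (real ^ 3) set) = (\<lambda>i. axis i 1) ` UNIV"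
    by (auto simp: Basis_vec_def)
  then show ?thesis by (simp add: UNIV_3)
qed

lemma tetrahedron_affine_image:
  "tetrahedron v = (\<lambda>y. edge_map v y + v 3) ` (convex hull (insert 0 Basis))"
proof -
  have "edge_map v ` insert 0 Basis = {0, v 1 - v 3, v 0 - v 3, v 2 - v 3}"
    by (simp add: Basis_real_3 edge_map_def axis_def)
  then have "edge_map v ` (convex hull (insert 0 Basis)) = convex hull {0, v 1 - v 3, v 0 - v 3, v 2 - v 3}"
    by (simp only: convex_hull_linear_image[OF linear_edge_map])
  then have "(\<lambda>x. v 3 + x) ` edge_map v ` (convex hull (insert 0 Basis))
     = convex hull ((\<lambda>x. v 3 + x) ` {0, v 1 - v 3, v 0 - v 3, v 2 - v 3})"
    by (simp only: convex_hull_translation)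
  also have "(\<lambda>x. v 3 + x) ` {0, v 1 - v 3, v 0 - v 3, v 2 - v 3} = v ` {..3}"
    by (auto simp: eval_nat_numeral atMost_Suc)
  finally show ?thesis
    by (simp add: tetrahedron_def image_image add.commute)
qed

section \<open>Evaluation of the simplex integral\<close>

lemma nn_integral_open_interval:
  fixes f :: "real \<Rightarrow> ennreal"
  shows "(\<integral>\<^sup>+x\<in>{a<..<b}. f x \<partial>lborel) = (\<integral>\<^sup>+x\<in>{a..b}. f x \<partial>lborel)"
proof (rule nn_integral_cong_AE)
  show "AE x in lborel. f x * indicator {a<..<b} x = f x * indicator {a..b} x"
    using AE_lborel_singleton[of a] AE_lborel_singleton[of b]
    by eventually_elim (auto split: split_indicator)
qed

lemma nn_integral_substitution_unit_interval:
  fixes f g g' :: "real \<Rightarrow> real"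
  assumes [measurable]: "f \<in> borel_measurable borel"
    and der: "\<And>x. 0 \<le> x \<Longrightarrow> x \<le> 1 \<Longrightarrow> (g has_real_derivative g' x) (at x)"
    and cont: "continuous_on {0..1} g'"
    and nonneg: "\<And>x. 0 \<le> x \<Longrightarrow> x \<le> 1 \<Longrightarrow> 0 \<le> g' x"
  shows "(\<integral>\<^sup>+x\<in>{g 0<..<g 1}. ennreal (f x) \<partial>lborel) = (\<integral>\<^sup>+x\<in>{0<..<1}. ennreal (f (g x) * g' x) \<partial>lborel)"
proof -
  have "(\<integral>\<^sup>+x. ennreal (f x * indicator {g 0..g 1} x) \<partial>lborel)
      = (\<integral>\<^sup>+x. ennreal (f (g x) * g' x * indicator {0..1} x) \<partial>lborel)"
    using der nonneg by (intro nn_integral_substitution cont) (auto simp: set_borel_measurable_def)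
  moreover have indicator: "ennreal (y * indicator A x) = ennreal y * indicator A x" for y x :: real and A
    by (simp split: split_indicator)
  ultimately show ?thesis
    unfolding nn_integral_open_interval by (simp only: indicator)
qed

text \<open>
  The integral over \<open>c = \<lambda>\<^sub>2\<close> with \<open>p = \<lambda>\<^sub>0\<close> and
  \<open>q = \<lambda>\<^sub>1\<close> fixed. The two linear factors add up to the constant \<open>1 + p - q\<close>, so
  partial fractions give two logarithms. Exchanging \<open>\<lambda>\<^sub>2\<close> and \<open>\<lambda>\<^sub>3\<close> swaps the
  factors, so both contribute equally, hence the factor \<open>2\<close>.
\<close>
lemma nn_integral_inner_edge:
  fixes p q K :: real
  assumes "0 < p" "0 < q" "p + q < 1" "0 \<le> K"
  shows "(\<integral>\<^sup>+c\<in>{0..1 - p - q}. ennreal (K / ((p + c) * (1 - q - c))) \<partial>lborel)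
    = ennreal (2 * K * ln ((1 - q) / p) / (1 + p - q))"
proof -
  define F where "F = (\<lambda>c. K / (1 + p - q) * (ln (p + c) - ln (1 - q - c)))"
  have "(\<integral>\<^sup>+c\<in>{0..1 - p - q}. ennreal (K / ((p + c) * (1 - q - c))) \<partial>lborel)
     = ennreal (F (1 - p - q) - F 0)"
  proof (rule nn_integral_FTC_Icc)
    fix c assume "c \<in> {0..1 - p - q}"
    then have c: "0 \<le> c" "c \<le> 1 - p - q" by auto
    then have pos: "0 < p + c" "0 < 1 - q - c" using assms by auto
    then show "0 \<le> K / ((p + c) * (1 - q - c))" using assms by simp
    have "((\<lambda>c. ln (p + c) - ln (1 - q - c)) has_real_derivative
        1 / (p + c) * (0 + 1) - 1 / (1 - q - c) * (0 - 1)) (at c)"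
      using pos
      by (intro DERIV_diff DERIV_chain2[where f = ln] DERIV_ln_divide DERIV_add DERIV_const DERIV_ident)
        (auto intro!: derivative_eq_intros)
    then have "(F has_real_derivative K / (1 + p - q) * (1 / (p + c) * (0 + 1) - 1 / (1 - q - c) * (0 - 1))) (at c)"
      unfolding F_def by (intro DERIV_cmult)
    also have "K / (1 + p - q) * (1 / (p + c) * (0 + 1) - 1 / (1 - q - c) * (0 - 1)) = K / ((p + c) * (1 - q - c))"
    proof -
      have "1 + p - q = (p + c) + (1 - q - c)" by simp
      moreover have "K / (a + b) * (1 / a * (0 + 1) - 1 / b * (0 - 1)) = K / (a * b)"
        if "a > 0" "b > 0" for a b :: real
      proof -
        have "1 / a * (0 + 1) - 1 / b * (0 - 1) = (a + b) / (a * b)"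
          using that by (simp add: field_simps)
        then show ?thesis using that by simp
      qed
      ultimately show ?thesis using pos by metis
    qed
    finally show "(F has_real_derivative K / ((p + c) * (1 - q - c))) (at c)" .
  qed (use assms in auto)
  also have "F (1 - p - q) - F 0 = 2 * K * ln ((1 - q) / p) / (1 + p - q)"
  proof -
    have "ln ((1 - q) / p) = ln (1 - q) - ln p"
      using assms by (intro ln_divide_pos) auto
    then have "2 * K * ln ((1 - q) / p) / (1 + p - q) = K / (1 + p - q) * (2 * (ln (1 - q) - ln p))"
      by simp
    moreover have "F (1 - p - q) - F 0 = K / (1 + p - q) * (2 * (ln (1 - q) - ln p))"
    proof -
      have "p + (1 - p - q) = 1 - q" "1 - q - (1 - p - q) = p"
        by simp_all
      moreover have "C * (a - b) - C * (b - a) = C * (2 * (a - b))" for a b C :: real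
        by (simp add: algebra_simps)
      ultimately show ?thesis
        by (simp only: F_def add_0_right diff_zero)
    qed
    ultimately show ?thesis by (simp only:)
  qed
  finally show ?thesis .
qed

definition simplex_integrand :: "nat \<Rightarrow> real ^ 3 \<Rightarrow> real" where
  "simplex_integrand n y = y $ 1 ^ n / ((y $ 2 + y $ 1) ^ (n + 1) * (y $ 2 + y $ 3) * (1 - y $ 1 - y $ 3))"

lemma std_simplex_3:
  "vector [q, p, c] \<in> convex hull (insert 0 Basis :: (real ^ 3) set) \<longleftrightarrow> 0 \<le> q \<and> 0 \<le> p \<and> 0 \<le> c \<and> q + p + c \<le> 1"
proof -
  show ?thesis
    unfolding std_simplex unfolding Basis_real_3 by (simp add: inner_axis vector_3 axis_eq_axis add.assoc)
qed

text \<open>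
  After the integration over \<open>\<lambda>\<^sub>2\<close>, two substitutions in one variable map the remaining triangle
  to the unit square. For fixed \<open>q = \<lambda>\<^sub>1\<close> put \<open>p = (1 - q) * u\<close>, which turns the logarithm
  into \<open>- ln u\<close>; after exchanging the integrals, for fixed \<open>u\<close> put \<open>q = x * u / (1 - x + x * u)\<close>,
  that is \<open>x = q / (p + q)\<close>, which turns the remaining quotient of powers into \<open>x ^ n\<close>.
\<close>
lemma nn_integral_simplex_eq_log_kernel:
  "(\<integral>\<^sup>+y\<in>convex hull (insert 0 Basis). ennreal (simplex_integrand n y) \<partial>lborel) = 2 * log_kernel_integral n"
proof -
  let ?I = "{0<..<1::real}" and ?S = "convex hull (insert 0 Basis) :: (real ^ 3) set"
  let ?k = "\<lambda>q p c. ennreal (simplex_integrand n (vector [q, p, c])) * indicator ?S (vector [q, p, c])"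
  define M where "M = (\<lambda>q u :: real. 2 * (q ^ n * - ln u / ((q + (1 - q) * u) ^ (n + 1) * (1 + u))))"
  have M_measurable [measurable]: "case_prod M \<in> borel_measurable (borel \<Otimes>\<^sub>M borel)"
    unfolding M_def by measurable
  have [measurable]: "?S \<in> sets borel"
    by (intro borel_closed compact_imp_closed finite_imp_compact_convex_hull) simp
  have [measurable]: "simplex_integrand n \<in> borel_measurable borel"
    unfolding simplex_integrand_def by measurable
  \<comment> \<open>Endpoint values of \<open>q\<close> and \<open>p\<close> are left out: there the denominators may vanish, but these
    are null sets.\<close>
  have inner: "(\<integral>\<^sup>+p. \<integral>\<^sup>+c. ?k q p c \<partial>lborel \<partial>lborel) = (\<integral>\<^sup>+u\<in>?I. ennreal (M q u) \<partial>lborel) * indicator ?I q"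
    if "q \<noteq> 0" "q \<noteq> 1" for q
  proof (cases "q \<in> ?I")
    case False
    then have "q < 0 \<or> 1 < q" using that by auto
    then have "?k q p c = 0" for p c
      by (auto simp: std_simplex_3 indicator_def)
    then show ?thesis using False by (simp only:) simp
  next
    case True
    then have q: "0 < q" "q < 1" by auto
    let ?h = "\<lambda>p. 2 * (q ^ n / (p + q) ^ (n + 1)) * ln ((1 - q) / p) / (1 + p - q)"
    have "(\<integral>\<^sup>+p. \<integral>\<^sup>+c. ?k q p c \<partial>lborel \<partial>lborel) = (\<integral>\<^sup>+p\<in>{0<..<1 - q}. ennreal (?h p) \<partial>lborel)"
    proof (rule nn_integral_cong_AE)
      have slice: "(\<integral>\<^sup>+c. ?k q p c \<partial>lborel) = ennreal (?h p) * indicator {0<..<1 - q} p"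
        if p: "p \<noteq> 0" "p \<noteq> 1 - q" for p
      proof (cases "0 < p \<and> p < 1 - q")
        case True
        have "?k q p c = ennreal (q ^ n / (p + q) ^ (n + 1) / ((p + c) * (1 - q - c))) * indicator {0..1 - p - q} c" for c
          using q True
          by (auto simp: std_simplex_3 simplex_integrand_def vector_3 mult.assoc split: split_indicator)
        then have "(\<integral>\<^sup>+c. ?k q p c \<partial>lborel) = ennreal (?h p)"
          using q True by (simp only:) (intro nn_integral_inner_edge, auto)
        then show ?thesis using True by simp
      next
        case False
        then have "p < 0 \<or> 1 - q < p" using p by auto
        then have "?k q p c = 0" for c
          by (auto simp: std_simplex_3 indicator_def)
        then show ?thesis using False by (simp only:) simp
      qed
      show "AE p in lborel. (\<integral>\<^sup>+c. ?k q p c \<partial>lborel) = ennreal (?h p) * indicator {0<..<1 - q} p"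
        using AE_lborel_singleton[of 0] AE_lborel_singleton[of "1 - q"] by eventually_elim (rule slice)
    qed
    also have "\<dots> = (\<integral>\<^sup>+p\<in>{(1 - q) * 0<..<(1 - q) * 1}. ennreal (?h p) \<partial>lborel)"
      by simp
    also have "\<dots> = (\<integral>\<^sup>+u\<in>?I. ennreal (?h ((1 - q) * u) * (1 - q)) \<partial>lborel)"
      using q by (intro nn_integral_substitution_unit_interval) (auto intro!: derivative_eq_intros)
    also have "\<dots> = (\<integral>\<^sup>+u\<in>?I. ennreal (M q u) \<partial>lborel)"
    proof (rule set_nn_integral_cong[OF refl refl])
      fix u :: real assume u: "u \<in> space lborel \<inter> ?I"
      have "(1 - q) / ((1 - q) * u) = inverse u"
        using q u by (simp add: field_simps)
      then have ln: "ln ((1 - q) / ((1 - q) * u)) = - ln u"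
        using u by (simp add: ln_inverse)
      have "1 + (1 - q) * u - q = (1 - q) * (1 + u)"
        by (simp add: algebra_simps)
      then have "?h ((1 - q) * u) * (1 - q) = M q u"
        using q u unfolding ln M_def by (simp add: add.commute)
      then show "ennreal (?h ((1 - q) * u) * (1 - q)) = ennreal (M q u)" by simp
    qed
    finally show ?thesis using True by simp
  qed
  have outer: "(\<integral>\<^sup>+q\<in>?I. ennreal (M q u) \<partial>lborel)
      = 2 * (\<integral>\<^sup>+x\<in>?I. ennreal (x ^ n * - ln u / ((1 + u) * (1 - x + x * u))) \<partial>lborel)"
    if u: "0 < u" "u < 1" for u
  proof -
    define g where "g = (\<lambda>x. x * u / (1 - x + x * u))"
    have pos: "0 < 1 - x + x * u" if "0 \<le> x" "x \<le> 1" for x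
    proof (cases "x = 1")
      case False
      then show ?thesis using that u by (intro add_pos_nonneg) auto
    qed (use u in simp)
    have "(\<integral>\<^sup>+q\<in>{g 0<..<g 1}. ennreal (M q u) \<partial>lborel)
        = (\<integral>\<^sup>+x\<in>?I. ennreal (M (g x) u * (u / (1 - x + x * u)\<^sup>2)) \<partial>lborel)"
    proof (intro nn_integral_substitution_unit_interval)
      fix x :: real assume x: "0 \<le> x" "x \<le> 1"
      show "(g has_real_derivative u / (1 - x + x * u)\<^sup>2) (at x)"
        unfolding g_def using pos[OF x]
        by (auto intro!: derivative_eq_intros simp: power2_eq_square) (simp add: algebra_simps)
      show "0 \<le> u / (1 - x + x * u)\<^sup>2" using u by simp
    next
      show "continuous_on {0..1} (\<lambda>x. u / (1 - x + x * u)\<^sup>2)"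
        using pos by (intro continuous_intros) (auto simp: less_le)
      show "(\<lambda>q. M q u) \<in> borel_measurable borel" by measurable
    qed
    also have "\<dots> = (\<integral>\<^sup>+x\<in>?I. 2 * ennreal (x ^ n * - ln u / ((1 + u) * (1 - x + x * u))) \<partial>lborel)"
    proof (rule set_nn_integral_cong[OF refl refl])
      fix x :: real assume x: "x \<in> space lborel \<inter> ?I"
      define D where "D = 1 - x + x * u"
      have D: "0 < D" using pos[of x] x by (simp add: D_def)
      have gx: "g x = x * u / D" by (simp add: g_def D_def)
      have "D - x * u = 1 - x" by (simp add: D_def)
      then have "1 - g x = (1 - x) / D"
        using D by (simp add: gx field_simps)
      then have "g x + (1 - g x) * u = x * u / D + (1 - x) / D * u"
        by (simp only:) (simp only: gx)
      also have "\<dots> = u / D"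
        by (simp add: algebra_simps flip: add_divide_distrib)
      finally have "g x + (1 - g x) * u = u / D" .
      then have "M (g x) u * (u / D\<^sup>2) = 2 * ((x * u / D) ^ n * - ln u / ((u / D) ^ (n + 1) * (1 + u))) * (u / D\<^sup>2)"
        by (simp only: M_def gx)
      also have "(x * u / D) ^ n = x ^ n * (u / D) ^ n"
        by (simp flip: power_mult_distrib)
      also have "2 * (x ^ n * (u / D) ^ n * - ln u / ((u / D) ^ (n + 1) * (1 + u))) * (u / D\<^sup>2)
         = 2 * (x ^ n * - ln u / ((1 + u) * D))"
      proof -
        have *: "2 * (a * b ^ n * l / (b ^ (n + 1) * c)) * (b / d) = 2 * (a * l / (c * d))"
          if "b > 0" for a b c d l :: real
          using that by simp
        have "u / D\<^sup>2 = (u / D) / D" by (simp add: power2_eq_square)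
        then show ?thesis using *[of "u / D" "x ^ n" "- ln u" "1 + u" D] u D by simp
      qed
      finally show "ennreal (M (g x) u * (u / (1 - x + x * u)\<^sup>2))
          = 2 * ennreal (x ^ n * - ln u / ((1 + u) * (1 - x + x * u)))"
        unfolding D_def by (simp only: ennreal_mult' ennreal_numeral zero_le_numeral)
    qed
    also have "\<dots> = 2 * (\<integral>\<^sup>+x\<in>?I. ennreal (x ^ n * - ln u / ((1 + u) * (1 - x + x * u))) \<partial>lborel)"
      by (subst nn_integral_cmult[symmetric]) (simp_all add: mult.assoc)
    finally show ?thesis using u by (simp add: g_def)
  qed
  have "(\<integral>\<^sup>+y\<in>?S. ennreal (simplex_integrand n y) \<partial>lborel)
      = (\<integral>\<^sup>+q. \<integral>\<^sup>+p. \<integral>\<^sup>+c. ?k q p c \<partial>lborel \<partial>lborel \<partial>lborel)"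
    by (intro nn_integral_vector_3) measurable
  also have "\<dots> = (\<integral>\<^sup>+q\<in>?I. (\<integral>\<^sup>+u\<in>?I. ennreal (M q u) \<partial>lborel) \<partial>lborel)"
  proof (rule nn_integral_cong_AE)
    show "AE q in lborel. (\<integral>\<^sup>+p. \<integral>\<^sup>+c. ?k q p c \<partial>lborel \<partial>lborel)
        = (\<integral>\<^sup>+u\<in>?I. ennreal (M q u) \<partial>lborel) * indicator ?I q"
      using AE_lborel_singleton[of 0] AE_lborel_singleton[of 1] by eventually_elim (rule inner)
  qed
  also have "\<dots> = (\<integral>\<^sup>+q. \<integral>\<^sup>+u. ennreal (M q u) * indicator ?I u * indicator ?I q \<partial>lborel \<partial>lborel)"
    by (intro nn_integral_cong nn_integral_multc[symmetric]) measurable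
  also have "\<dots> = (\<integral>\<^sup>+u. \<integral>\<^sup>+q. ennreal (M q u) * indicator ?I u * indicator ?I q \<partial>lborel \<partial>lborel)"
    by (intro lborel_pair.Fubini') measurable
  also have "\<dots> = (\<integral>\<^sup>+u. 2 * ((\<integral>\<^sup>+x\<in>?I. ennreal (x ^ n * - ln u / ((1 + u) * (1 - x + x * u))) \<partial>lborel) * indicator ?I u) \<partial>lborel)"
  proof (intro nn_integral_cong)
    fix u :: real
    show "(\<integral>\<^sup>+q. ennreal (M q u) * indicator ?I u * indicator ?I q \<partial>lborel)
        = 2 * ((\<integral>\<^sup>+x\<in>?I. ennreal (x ^ n * - ln u / ((1 + u) * (1 - x + x * u))) \<partial>lborel) * indicator ?I u)"
      using outer[of u] by (cases "u \<in> ?I") simp_all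
  qed
  also have "\<dots> = 2 * log_kernel_integral n"
    unfolding log_kernel_integral_def by (intro nn_integral_cmult) measurable
  finally show ?thesis .
qed

theorem theorem4p18:
  fixes v :: "nat \<Rightarrow> real ^ 3" and n :: nat
  assumes "tetrahedron_vertices v"
  shows "F_mean v n =
           21 / 2 ^ n * zeta3
         + pi ^ 2 / 2 ^ n * (\<Sum>m=1..n. 2 ^ (m - 1) / real m)
         + 3 / 2 ^ n * (\<Sum>m=1..n. 2 ^ m / real m * (harm (m - 1) ^ 2 + harm2 (m - 1)))"
proof -
  let ?S = "convex hull (insert 0 Basis) :: (real ^ 3) set"
  let ?f = "\<lambda>x. barycentric v 1 x ^ n /
        ((barycentric v 0 x + barycentric v 1 x) ^ (n + 1) *
         (barycentric v 0 x + barycentric v 2 x) *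
         (barycentric v 0 x + barycentric v 3 x))"
  have f: "?f (edge_map v y + v 3) = simplex_integrand n y" for y
    by (simp add: barycentric_affine[OF assms] simplex_coords_def simplex_integrand_def)
  have "compact ?S"
    by (intro finite_imp_compact_convex_hull) simp
  then have S: "?S \<in> lmeasurable" and [measurable]: "?S \<in> sets borel"
    by (auto intro: lmeasurable_compact borel_compact)
  have [measurable]: "simplex_integrand n \<in> borel_measurable borel"
    unfolding simplex_integrand_def by measurable
  let ?g = "\<lambda>y. indicator ?S y *\<^sub>R simplex_integrand n y"
  have nonneg: "0 \<le> ?g y" for y
  proof (cases "y \<in> ?S")
    case True
    moreover have "y = vector [y $ 1, y $ 2, y $ 3]"
      by (simp add: vec_eq_iff forall_3 vector_3)
    ultimately have "0 \<le> y $ 1 \<and> 0 \<le> y $ 2 \<and> 0 \<le> y $ 3 \<and> y $ 1 + y $ 2 + y $ 3 \<le> 1"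
      using std_simplex_3 by metis
    then show ?thesis by (simp add: simplex_integrand_def)
  qed simp
  have "(\<integral>\<^sup>+y. ennreal (?g y) \<partial>lborel) = (\<integral>\<^sup>+y\<in>?S. ennreal (simplex_integrand n y) \<partial>lborel)"
    by (intro nn_integral_cong) (simp split: split_indicator)
  then have nn: "(\<integral>\<^sup>+y. ennreal (?g y) \<partial>lborel) = 2 * log_kernel_integral n"
    by (simp only: nn_integral_simplex_eq_log_kernel)
  have "integrable lborel ?g"
    using nonneg nn log_kernel_integral_finite[of n]
    by (intro integrableI_nonneg) (auto simp: ennreal_mult_less_top)
  then have abs: "simplex_integrand n absolutely_integrable_on ?S"
    by (simp add: set_integrable_def integrable_completion)
  have "(LINT y:?S|lebesgue. simplex_integrand n y) = (\<integral>y. ?g y \<partial>lborel)"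
    unfolding set_lebesgue_integral_def by (intro integral_completion) measurable
  also have "\<dots> = enn2real (\<integral>\<^sup>+y. ennreal (?g y) \<partial>lborel)"
    using nonneg by (intro integral_eq_nn_integral) auto
  also have "\<dots> = 2 * enn2real (log_kernel_integral n)"
    unfolding nn by (simp add: enn2real_mult)
  finally have LINT: "(LINT y:?S|lebesgue. simplex_integrand n y) = 2 * enn2real (log_kernel_integral n)" .
  have "measure lebesgue ?S = 1 / 6"
    using content_std_simplex[where 'a = "real ^ 3"] by (simp add: fact_numeral)
  moreover have "F_mean v n = mean_value ?S (\<lambda>y. ?f (edge_map v y + v 3))"
    unfolding F_mean_def tetrahedron_affine_image
    using abs by (intro mean_value_affine_image linear_edge_map inj_edge_map assms S) (simp only: f)
  ultimately have "F_mean v n = 12 * enn2real (log_kernel_integral n)"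
    unfolding f by (simp only: mean_value_def LINT) simp
  then show ?thesis
    by (simp only: log_kernel_integral_closed_form)
qed

end
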